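(* Let $F$ be a field and let $P$ and $U$ be Poisson algebras over $F$ with $U$ finite dimensional. (1) There exists a functor $\mathcal{L}(-,U)\colon \mathbf{Poiss}_F\to\mathbf{Poiss}_F$ defined as follows: for Poisson algebras $X,Y$ and a morphism $f\colon X\to Y$ in $\mathbf{Poiss}_F$, $\mathcal{L}(X,U)=\mathcal{B}(X,U)$ and $\mathcal{L}(f,U)=\overline{f}$, where $\overline{f}\colon\mathcal{B}(X,U)\to\mathcal{B}(Y,U)$ is the unique Poisson algebra homomorphism such that $(\mathrm{id}_U\otimes\overline{f})\circ\psi_{\mathcal{B}(X,U)}=\psi_{\mathcal{B}(Y,U)}\circ f$. (2) There exists a functor $\mathcal{R}(P,-)\colon(\mathbf{Poiss}_F^{fd})^{op}\to\mathbf{Poiss}_F$ defined as follows: for finite dimensional Poisson algebras $A,B$ and a morphism $f^{op}\colon A\to B$ in $(\mathbf{Poiss}_F^{fd})^{op}$ (i.e. a Poisson algebra homomorphism $f\colon B\to A$), $\mathcal{R}(P,A)=\mathcal{B}(P,A)$ and $\mathcal{R}(P,f^{op})=\overline{f}$, where $\overline{f}\colon\mathcal{B}(P,A)\to\mathcal{B}(P,B)$ is the unique Poisson algebra homomorphism such that $(\mathrm{id}_A\otimes\overline{f})\circ\psi_{\mathcal{B}(P,A)}=(f\otimes\mathrm{id}_{\mathcal{B}(P,B)})\circ\psi_{\mathcal{B}(P,B)}$.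
   Context: All vector spaces, algebras and tensor products are over the field $F$, and algebras are associative and unital. A Poisson algebra is a vector space $P$ carrying both a commutative associative unital algebra structure and a Lie algebra structure $[\cdot,\cdot]$ such that $[p,qr]=[p,q]\,r+q\,[p,r]$ for all $p,q,r\in P$. A morphism of Poisson algebras is a linear map that is both a (unital) algebra homomorphism and a Lie algebra homomorphism. $\mathbf{Poiss}_F$ denotes the category of Poisson algebras over $F$ and $\mathbf{Poiss}_F^{fd}$ its full subcategory of finite dimensional Poisson algebras. If $P_1,P_2$ are Poisson algebras, $P_1\otimes P_2$ is a Poisson algebra with $(p\otimes q)(r\otimes s)=pr\otimes qs$ and $[p\otimes q,r\otimes s]=pr\otimes[q,s]_{P_2}+[p,r]_{P_1}\otimes qs$. For Poisson algebras $X$ and $U$ with $U$ finite dimensional, $(\mathcal{B}(X,U),\psi_{\mathcal{B}(X,U)})$ denotes the universal Poisson algebra of $X$ and $U$ (which exists): a Poisson algebra $\mathcal{B}(X,U)$ with a Poisson algebra homomorphism $\psi_{\mathcal{B}(X,U)}\colon X\to U\otimes\mathcal{B}(X,U)$ such that for every Poisson algebra $Q$ and every Poisson algebra homomorphism $f\colon X\to U\otimes Q$ there is a unique Poisson algebra homomorphism $g\colon\mathcal{B}(X,U)\to Q$ with $(\mathrm{id}_U\otimes g)\circ\psi_{\mathcal{B}(X,U)}=f$. *)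

theory Defs
  imports
    "HOL-Algebra.Free_Abelian_Groups"
    "Jordan_Normal_Form.Missing_VectorSpace"
begin

section \<open>Poisson algebras\<close>

record ('f, 'a) poisson = "('f, 'a) module" +
  bracket :: "['a, 'a] \<Rightarrow> 'a" (\<open>\<lbrace>_,/ _\<rbrace>\<index>\<close>)

locale lie_algebra = vectorspace F L
  for F :: "('f, 'm) ring_scheme" and L :: "('f, 'a, 'x) poisson_scheme" (structure) +
  assumes bracket_closed:
      "\<lbrakk>x \<in> carrier L; y \<in> carrier L\<rbrakk> \<Longrightarrow> \<lbrace>x, y\<rbrace> \<in> carrier L"
    and bracket_add_left:
      "\<lbrakk>x \<in> carrier L; y \<in> carrier L; z \<in> carrier L\<rbrakk> \<Longrightarrow> \<lbrace>x \<oplus> y, z\<rbrace> = \<lbrace>x, z\<rbrace> \<oplus> \<lbrace>y, z\<rbrace>"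
    and bracket_add_right:
      "\<lbrakk>x \<in> carrier L; y \<in> carrier L; z \<in> carrier L\<rbrakk> \<Longrightarrow> \<lbrace>x, y \<oplus> z\<rbrace> = \<lbrace>x, y\<rbrace> \<oplus> \<lbrace>x, z\<rbrace>"
    and bracket_smult_left:
      "\<lbrakk>a \<in> carrier F; x \<in> carrier L; y \<in> carrier L\<rbrakk> \<Longrightarrow> \<lbrace>a \<odot> x, y\<rbrace> = a \<odot> \<lbrace>x, y\<rbrace>"
    and bracket_smult_right:
      "\<lbrakk>a \<in> carrier F; x \<in> carrier L; y \<in> carrier L\<rbrakk> \<Longrightarrow> \<lbrace>x, a \<odot> y\<rbrace> = a \<odot> \<lbrace>x, y\<rbrace>"
    and bracket_self: "x \<in> carrier L \<Longrightarrow> \<lbrace>x, x\<rbrace> = \<zero>"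
    and jacobi:
      "\<lbrakk>x \<in> carrier L; y \<in> carrier L; z \<in> carrier L\<rbrakk> \<Longrightarrow>
        \<lbrace>x, \<lbrace>y, z\<rbrace>\<rbrace> \<oplus> \<lbrace>y, \<lbrace>z, x\<rbrace>\<rbrace> \<oplus> \<lbrace>z, \<lbrace>x, y\<rbrace>\<rbrace> = \<zero>"

text \<open>The locale \<open>algebra\<close> of HOL-Algebra is that of commutative, associative and unital algebras.\<close>

locale poisson_algebra = algebra F P + lie_algebra F P
  for F :: "('f, 'm) ring_scheme" and P :: "('f, 'a, 'x) poisson_scheme" (structure) +
  assumes leibniz:
    "\<lbrakk>p \<in> carrier P; q \<in> carrier P; r \<in> carrier P\<rbrakk> \<Longrightarrow> \<lbrace>p, q \<otimes> r\<rbrace> = \<lbrace>p, q\<rbrace> \<otimes> r \<oplus> q \<otimes> \<lbrace>p, r\<rbrace>"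

text \<open>Homomorphisms are normalised to be \<open>undefined\<close> off the carrier of their domain, so that two of
  them are equal iff they agree as maps on that carrier.\<close>

definition poisson_hom ::
    "('f, 'm) ring_scheme \<Rightarrow> ('f, 'a, 'x) poisson_scheme \<Rightarrow> ('f, 'b, 'y) poisson_scheme \<Rightarrow> ('a \<Rightarrow> 'b) set"
  where "poisson_hom F A B =
    {h \<in> module_hom F A B \<inter> ring_hom A B \<inter> extensional (carrier A).
      \<forall>x\<in>carrier A. \<forall>y\<in>carrier A. h \<lbrace>x, y\<rbrace>\<^bsub>A\<^esub> = \<lbrace>h x, h y\<rbrace>\<^bsub>B\<^esub>}"


section \<open>Tensor products\<close>

text \<open>The tensor product of \<open>U\<close> and \<open>Q\<close> over \<open>F\<close> is the free abelian group on
  \<open>carrier U \<times> carrier Q\<close> modulo the subgroup generated by the usual bilinearity relations.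
  Its elements are cosets; the product, the bracket, scalar multiplication and
  \<open>f \<otimes> g\<close> are computed on arbitrary representatives by (bi)additive extension from the generators
  \<open>frag_of (u, q)\<close>, which stand for the pure tensors.  Independence of the
  representatives is shown below (\<open>smult_frag\<close>, \<open>mult_frag\<close>, \<open>bracket_frag\<close>,
  \<open>tensor_map_class\<close>), and so are the formulas on pure tensors (\<open>mult_pure\<close>,
  \<open>bracket_pure\<close>, \<open>smult_pure\<close>, \<open>tensor_map_pure\<close>) and the fact that
  the result is a Poisson algebra (\<open>tensor_product_poisson\<close>).\<close>

definition tensor_rels ::
    "('f, 'm) ring_scheme \<Rightarrow> ('f, 'a, 'x) module_scheme \<Rightarrow> ('f, 'b, 'y) module_scheme \<Rightarrow> ('a \<times> 'b \<Rightarrow>\<^sub>0 int) set"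
  where "tensor_rels F U Q =
    {frag_of (u \<oplus>\<^bsub>U\<^esub> u', q) - frag_of (u, q) - frag_of (u', q) | u u' q.
        u \<in> carrier U \<and> u' \<in> carrier U \<and> q \<in> carrier Q} \<union>
    {frag_of (u, q \<oplus>\<^bsub>Q\<^esub> q') - frag_of (u, q) - frag_of (u, q') | u q q'.
        u \<in> carrier U \<and> q \<in> carrier Q \<and> q' \<in> carrier Q} \<union>
    {frag_of (a \<odot>\<^bsub>U\<^esub> u, q) - frag_of (u, a \<odot>\<^bsub>Q\<^esub> q) | a u q.
        a \<in> carrier F \<and> u \<in> carrier U \<and> q \<in> carrier Q}"

abbreviation tensor_free ::
    "('f, 'a, 'x) module_scheme \<Rightarrow> ('f, 'b, 'y) module_scheme \<Rightarrow> ('a \<times> 'b \<Rightarrow>\<^sub>0 int) monoid"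
  where "tensor_free U Q \<equiv> free_Abelian_group (carrier U \<times> carrier Q)"

definition tensor_ker ::
    "('f, 'm) ring_scheme \<Rightarrow> ('f, 'a, 'x) module_scheme \<Rightarrow> ('f, 'b, 'y) module_scheme \<Rightarrow> ('a \<times> 'b \<Rightarrow>\<^sub>0 int) set"
  where "tensor_ker F U Q = generate (tensor_free U Q) (tensor_rels F U Q)"

definition tensor_class ::
    "('f, 'm) ring_scheme \<Rightarrow> ('f, 'a, 'x) module_scheme \<Rightarrow> ('f, 'b, 'y) module_scheme \<Rightarrow>
      ('a \<times> 'b \<Rightarrow>\<^sub>0 int) \<Rightarrow> ('a \<times> 'b \<Rightarrow>\<^sub>0 int) set"
  where "tensor_class F U Q x = tensor_ker F U Q #>\<^bsub>tensor_free U Q\<^esub> x"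

definition tensor_rep :: "('a \<times> 'b \<Rightarrow>\<^sub>0 int) set \<Rightarrow> ('a \<times> 'b \<Rightarrow>\<^sub>0 int)"
  where "tensor_rep T = (SOME x. x \<in> T)"

definition pure_tensor ::
    "('f, 'm) ring_scheme \<Rightarrow> ('f, 'a, 'x) module_scheme \<Rightarrow> ('f, 'b, 'y) module_scheme \<Rightarrow>
      'a \<Rightarrow> 'b \<Rightarrow> ('a \<times> 'b \<Rightarrow>\<^sub>0 int) set"
  where "pure_tensor F U Q u q = tensor_class F U Q (frag_of (u, q))"

definition frag_smult ::
    "('f, 'a, 'x) module_scheme \<Rightarrow> 'f \<Rightarrow> ('a \<times> 'b \<Rightarrow>\<^sub>0 int) \<Rightarrow> ('a \<times> 'b \<Rightarrow>\<^sub>0 int)"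
  where "frag_smult U a = frag_extend (\<lambda>(u, q). frag_of (a \<odot>\<^bsub>U\<^esub> u, q))"

definition frag_mult ::
    "('f, 'a, 'x) module_scheme \<Rightarrow> ('f, 'b, 'y) module_scheme \<Rightarrow>
      ('a \<times> 'b \<Rightarrow>\<^sub>0 int) \<Rightarrow> ('a \<times> 'b \<Rightarrow>\<^sub>0 int) \<Rightarrow> ('a \<times> 'b \<Rightarrow>\<^sub>0 int)"
  where "frag_mult U Q x y =
    frag_extend (\<lambda>(p, q). frag_extend (\<lambda>(r, s). frag_of (p \<otimes>\<^bsub>U\<^esub> r, q \<otimes>\<^bsub>Q\<^esub> s)) y) x"

definition frag_bracket ::
    "('f, 'a, 'x) poisson_scheme \<Rightarrow> ('f, 'b, 'y) poisson_scheme \<Rightarrow>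
      ('a \<times> 'b \<Rightarrow>\<^sub>0 int) \<Rightarrow> ('a \<times> 'b \<Rightarrow>\<^sub>0 int) \<Rightarrow> ('a \<times> 'b \<Rightarrow>\<^sub>0 int)"
  where "frag_bracket U Q x y =
    frag_extend (\<lambda>(p, q). frag_extend (\<lambda>(r, s).
      frag_of (p \<otimes>\<^bsub>U\<^esub> r, \<lbrace>q, s\<rbrace>\<^bsub>Q\<^esub>) + frag_of (\<lbrace>p, r\<rbrace>\<^bsub>U\<^esub>, q \<otimes>\<^bsub>Q\<^esub> s)) y) x"

definition tensor_product ::
    "('f, 'm) ring_scheme \<Rightarrow> ('f, 'a, 'x) poisson_scheme \<Rightarrow> ('f, 'b, 'y) poisson_scheme \<Rightarrow>
      ('f, ('a \<times> 'b \<Rightarrow>\<^sub>0 int) set) poisson"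
  where "tensor_product F U Q =
    \<lparr>carrier = carrier (tensor_free U Q Mod tensor_ker F U Q),
     mult = (\<lambda>S T. tensor_class F U Q (frag_mult U Q (tensor_rep S) (tensor_rep T))),
     one = pure_tensor F U Q \<one>\<^bsub>U\<^esub> \<one>\<^bsub>Q\<^esub>,
     zero = \<one>\<^bsub>tensor_free U Q Mod tensor_ker F U Q\<^esub>,
     add = (\<lambda>S T. S \<otimes>\<^bsub>tensor_free U Q Mod tensor_ker F U Q\<^esub> T),
     smult = (\<lambda>a T. tensor_class F U Q (frag_smult U a (tensor_rep T))),
     bracket = (\<lambda>S T. tensor_class F U Q (frag_bracket U Q (tensor_rep S) (tensor_rep T)))\<rparr>"

text \<open>\<open>tensor_map F U Q f g\<close> is \<open>f \<otimes> g\<close>, where \<open>U\<close> and \<open>Q\<close> are the codomains of \<open>f\<close> and \<open>g\<close>.\<close>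

definition tensor_map ::
    "('f, 'm) ring_scheme \<Rightarrow> ('f, 'a, 'x) module_scheme \<Rightarrow> ('f, 'b, 'y) module_scheme \<Rightarrow>
      ('c \<Rightarrow> 'a) \<Rightarrow> ('d \<Rightarrow> 'b) \<Rightarrow> ('c \<times> 'd \<Rightarrow>\<^sub>0 int) set \<Rightarrow> ('a \<times> 'b \<Rightarrow>\<^sub>0 int) set"
  where "tensor_map F U Q f g T =
    tensor_class F U Q (frag_extend (\<lambda>(u, q). frag_of (f u, g q)) (tensor_rep T))"


subsection \<open>Independence of representatives, and the Poisson structure on the tensor product\<close>

locale two_modules = U: module F U + Q: module F Q
  for F :: "('f, 'm) ring_scheme" and U :: "('f, 'a, 'x) module_scheme" and Q :: "('f, 'b, 'y) module_scheme"
begin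

abbreviation "G \<equiv> tensor_free U Q"
abbreviation "N \<equiv> tensor_ker F U Q"
abbreviation "cls \<equiv> tensor_class F U Q"
abbreviation "pt \<equiv> pure_tensor F U Q"

lemma G_diff: "x \<in> carrier G \<Longrightarrow> y \<in> carrier G \<Longrightarrow> x - y \<in> carrier G"
  using keys_diff[of x y] by auto
lemma G_add: "x \<in> carrier G \<Longrightarrow> y \<in> carrier G \<Longrightarrow> x + y \<in> carrier G"
  using keys_add[of x y] by auto
lemma G_0: "0 \<in> carrier G" by simp
lemma G_of: "u \<in> carrier U \<Longrightarrow> q \<in> carrier Q \<Longrightarrow> frag_of (u, q) \<in> carrier G" by simp
lemma G_induct [consumes 1]:
  assumes "x \<in> carrier G" "\<Phi> 0"
    "\<And>x y. x \<in> carrier G \<Longrightarrow> y \<in> carrier G \<Longrightarrow> \<Phi> x \<Longrightarrow> \<Phi> y \<Longrightarrow> \<Phi> (x - y)"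
    "\<And>u q. u \<in> carrier U \<Longrightarrow> q \<in> carrier Q \<Longrightarrow> \<Phi> (frag_of (u, q))"
  shows "\<Phi> x"
  by (rule free_Abelian_group_induct[where S = "carrier U \<times> carrier Q"]) (use assms in auto)

lemma rels_carrier: "tensor_rels F U Q \<subseteq> carrier G"
  unfolding tensor_rels_def
  by (intro subsetI, elim UnE CollectE exE conjE; hypsubst; intro G_diff G_of; (assumption | rule U.smult_closed Q.smult_closed U.add.m_closed Q.add.m_closed)+)

lemma ker_subgroup: "subgroup N G"
  unfolding tensor_ker_def by (rule group.generate_is_subgroup[OF group_free_Abelian_group rels_carrier])

lemma ker_normal: "N \<lhd> G"
  using ker_subgroup by (simp add: abelian_free_Abelian_group comm_group.subgroup_imp_normal)

lemma ker_carrier: "x \<in> N \<Longrightarrow> x \<in> carrier G"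
  using subgroup.mem_carrier[OF ker_subgroup] .

lemma ker_0: "0 \<in> N" using subgroup.one_closed[OF ker_subgroup] by simp
lemma ker_add: "x \<in> N \<Longrightarrow> y \<in> N \<Longrightarrow> x + y \<in> N" using subgroup.m_closed[OF ker_subgroup] by simp
lemma ker_minus: "x \<in> N \<Longrightarrow> - x \<in> N"
  using subgroup.m_inv_closed[OF ker_subgroup, of x] ker_carrier[of x] by simp
lemma ker_diff: "x \<in> N \<Longrightarrow> y \<in> N \<Longrightarrow> x - y \<in> N" using ker_add[of x "-y"] ker_minus[of y] by simp

lemma ker_induct:
  assumes "x \<in> N" "\<And>r. r \<in> tensor_rels F U Q \<Longrightarrow> \<Phi> r" "\<Phi> 0"
    "\<And>x. \<Phi> x \<Longrightarrow> \<Phi> (- x)" "\<And>x y. \<Phi> x \<Longrightarrow> \<Phi> y \<Longrightarrow> \<Phi> (x + y)"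
  shows "\<Phi> x"
  using assms(1) unfolding tensor_ker_def
proof induction
  case (inv h)
  then have "Poly_Mapping.keys h \<subseteq> carrier U \<times> carrier Q" using subsetD[OF rels_carrier inv] by simp
  then show ?case using assms(4)[OF assms(2)[OF inv]] by (simp add: inv_free_Abelian_group)
qed (use assms in auto)

lemma in_cls: "z \<in> cls x \<longleftrightarrow> z - x \<in> N"
proof -
  have "z \<in> cls x \<longleftrightarrow> (\<exists>h\<in>N. z = h + x)" by (simp add: tensor_class_def r_coset_def)
  also have "\<dots> \<longleftrightarrow> z - x \<in> N" by (metis add_diff_cancel diff_add_cancel)
  finally show ?thesis .
qed

lemma cls_eq_iff: "cls x = cls y \<longleftrightarrow> x - y \<in> N"
proof
  assume "cls x = cls y"
  then show "x - y \<in> N" using in_cls[of x x] in_cls[of x y] ker_0 by simp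
next
  assume d: "x - y \<in> N"
  show "cls x = cls y"
  proof (rule Set.set_eqI)
    show "z \<in> cls x \<longleftrightarrow> z \<in> cls y" for z
      using ker_add[OF _ d, of "z - x"] ker_diff[OF _ d, of "z - y"] by (auto simp: in_cls)
  qed
qed

lemma rep_cls:
  assumes "x \<in> carrier G"
  shows "tensor_rep (cls x) \<in> carrier G" "tensor_rep (cls x) - x \<in> N"
proof -
  have "x \<in> cls x" using in_cls[of x x] ker_0 by simp
  then have "tensor_rep (cls x) \<in> cls x" unfolding tensor_rep_def by (rule someI)
  then show *: "tensor_rep (cls x) - x \<in> N" by (simp add: in_cls)
  show "tensor_rep (cls x) \<in> carrier G"
    using G_add[OF ker_carrier[OF *] assms] by simp
qed

lemma mod_carrier: "carrier (G Mod N) = cls ` carrier G"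
  by (auto simp: FactGroup_def RCOSETS_def tensor_class_def)

lemma mod_mult: "x \<in> carrier G \<Longrightarrow> y \<in> carrier G \<Longrightarrow> cls x \<otimes>\<^bsub>G Mod N\<^esub> cls y = cls (x + y)"
  using normal.rcos_sum[OF ker_normal, of x y] by (simp add: FactGroup_def tensor_class_def)

lemma mod_one: "\<one>\<^bsub>G Mod N\<^esub> = cls 0"
  using group.coset_mult_one[OF group_free_Abelian_group, of N "carrier U \<times> carrier Q"]
    ker_subgroup[THEN subgroup.subset]
  by (simp add: FactGroup_def tensor_class_def)

lemma mod_comm_group: "comm_group (G Mod N)"
  using abelian_free_Abelian_group comm_group.abelian_FactGroup ker_subgroup by blast

declare mult_FactGroup [simp del] one_FactGroup [simp del]

lemma rel_closed:
  "u \<in> carrier U \<Longrightarrow> u' \<in> carrier U \<Longrightarrow> q \<in> carrier Q \<Longrightarrow> frag_of (u \<oplus>\<^bsub>U\<^esub> u', q) - frag_of (u, q) - frag_of (u', q) \<in> N"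
  "u \<in> carrier U \<Longrightarrow> q \<in> carrier Q \<Longrightarrow> q' \<in> carrier Q \<Longrightarrow> frag_of (u, q \<oplus>\<^bsub>Q\<^esub> q') - frag_of (u, q) - frag_of (u, q') \<in> N"
  "a \<in> carrier F \<Longrightarrow> u \<in> carrier U \<Longrightarrow> q \<in> carrier Q \<Longrightarrow> frag_of (a \<odot>\<^bsub>U\<^esub> u, q) - frag_of (u, a \<odot>\<^bsub>Q\<^esub> q) \<in> N"
  unfolding tensor_ker_def tensor_rels_def by (rule generate.incl, blast)+


lemma lift_closed:
  assumes "x \<in> carrier G" "\<And>u q. u \<in> carrier U \<Longrightarrow> q \<in> carrier Q \<Longrightarrow> \<phi> (u, q) \<in> D"
    "0 \<in> D" "\<And>x y. x \<in> D \<Longrightarrow> y \<in> D \<Longrightarrow> x - y \<in> D"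
  shows "frag_extend \<phi> x \<in> D"
proof -
  have "x \<in> carrier G" by fact
  then show ?thesis
    by (induction x rule: G_induct) (use assms(2-4) in \<open>auto simp: frag_extend_diff\<close>)
qed

lemma lift_ker:
  assumes "x \<in> N"
    and 1: "\<And>u u' q. u \<in> carrier U \<Longrightarrow> u' \<in> carrier U \<Longrightarrow> q \<in> carrier Q \<Longrightarrow>
        \<phi> (u \<oplus>\<^bsub>U\<^esub> u', q) - \<phi> (u, q) - \<phi> (u', q) \<in> D"
    and 2: "\<And>u q q'. u \<in> carrier U \<Longrightarrow> q \<in> carrier Q \<Longrightarrow> q' \<in> carrier Q \<Longrightarrow>
        \<phi> (u, q \<oplus>\<^bsub>Q\<^esub> q') - \<phi> (u, q) - \<phi> (u, q') \<in> D"
    and 3: "\<And>a u q. a \<in> carrier F \<Longrightarrow> u \<in> carrier U \<Longrightarrow> q \<in> carrier Q \<Longrightarrow>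
        \<phi> (a \<odot>\<^bsub>U\<^esub> u, q) - \<phi> (u, a \<odot>\<^bsub>Q\<^esub> q) \<in> D"
    and D: "0 \<in> D" "\<And>x y. x \<in> D \<Longrightarrow> y \<in> D \<Longrightarrow> x - y \<in> D"
  shows "frag_extend \<phi> x \<in> D"
proof -
  have m: "- x \<in> D" if "x \<in> D" for x using D(2)[OF D(1) that] by simp
  have a: "x + y \<in> D" if "x \<in> D" "y \<in> D" for x y using D(2)[OF that(1) m[OF that(2)]] by simp
  have r: "frag_extend \<phi> r \<in> D" if "r \<in> tensor_rels F U Q" for r
    using that unfolding tensor_rels_def
    by (elim UnE CollectE exE conjE) (use 1 2 3 in \<open>simp_all add: frag_extend_diff\<close>)
  show ?thesis
    using assms(1)
    by (rule ker_induct) (use r m a D(1) in \<open>simp_all add: frag_extend_minus frag_extend_add\<close>)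
qed

lemma bi_ext:
  fixes \<beta> :: "'a \<times> 'b \<Rightarrow> 'a \<times> 'b \<Rightarrow> ('a \<times> 'b \<Rightarrow>\<^sub>0 int)"
  assumes c: "\<And>p q r s. p \<in> carrier U \<Longrightarrow> q \<in> carrier Q \<Longrightarrow> r \<in> carrier U \<Longrightarrow> s \<in> carrier Q \<Longrightarrow>
        \<beta> (p, q) (r, s) \<in> carrier G"
    and l1: "\<And>p p' q r s. p \<in> carrier U \<Longrightarrow> p' \<in> carrier U \<Longrightarrow> q \<in> carrier Q \<Longrightarrow> r \<in> carrier U \<Longrightarrow> s \<in> carrier Q \<Longrightarrow>
        \<beta> (p \<oplus>\<^bsub>U\<^esub> p', q) (r, s) - \<beta> (p, q) (r, s) - \<beta> (p', q) (r, s) \<in> N"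
    and l2: "\<And>p q q' r s. p \<in> carrier U \<Longrightarrow> q \<in> carrier Q \<Longrightarrow> q' \<in> carrier Q \<Longrightarrow> r \<in> carrier U \<Longrightarrow> s \<in> carrier Q \<Longrightarrow>
        \<beta> (p, q \<oplus>\<^bsub>Q\<^esub> q') (r, s) - \<beta> (p, q) (r, s) - \<beta> (p, q') (r, s) \<in> N"
    and l3: "\<And>a p q r s. a \<in> carrier F \<Longrightarrow> p \<in> carrier U \<Longrightarrow> q \<in> carrier Q \<Longrightarrow> r \<in> carrier U \<Longrightarrow> s \<in> carrier Q \<Longrightarrow>
        \<beta> (a \<odot>\<^bsub>U\<^esub> p, q) (r, s) - \<beta> (p, a \<odot>\<^bsub>Q\<^esub> q) (r, s) \<in> N"
    and r1: "\<And>p q r r' s. p \<in> carrier U \<Longrightarrow> q \<in> carrier Q \<Longrightarrow> r \<in> carrier U \<Longrightarrow> r' \<in> carrier U \<Longrightarrow> s \<in> carrier Q \<Longrightarrow>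
        \<beta> (p, q) (r \<oplus>\<^bsub>U\<^esub> r', s) - \<beta> (p, q) (r, s) - \<beta> (p, q) (r', s) \<in> N"
    and r2: "\<And>p q r s s'. p \<in> carrier U \<Longrightarrow> q \<in> carrier Q \<Longrightarrow> r \<in> carrier U \<Longrightarrow> s \<in> carrier Q \<Longrightarrow> s' \<in> carrier Q \<Longrightarrow>
        \<beta> (p, q) (r, s \<oplus>\<^bsub>Q\<^esub> s') - \<beta> (p, q) (r, s) - \<beta> (p, q) (r, s') \<in> N"
    and r3: "\<And>a p q r s. a \<in> carrier F \<Longrightarrow> p \<in> carrier U \<Longrightarrow> q \<in> carrier Q \<Longrightarrow> r \<in> carrier U \<Longrightarrow> s \<in> carrier Q \<Longrightarrow>
        \<beta> (p, q) (a \<odot>\<^bsub>U\<^esub> r, s) - \<beta> (p, q) (r, a \<odot>\<^bsub>Q\<^esub> s) \<in> N"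
  defines "b \<equiv> \<lambda>x y. frag_extend (\<lambda>i. frag_extend (\<beta> i) y) x"
  shows bi_ext_closed: "\<And>x y. x \<in> carrier G \<Longrightarrow> y \<in> carrier G \<Longrightarrow> b x y \<in> carrier G"
    and bi_ext_add_left: "\<And>x x' y. b (x + x') y = b x y + b x' y"
    and bi_ext_add_right: "\<And>x y y'. x \<in> carrier G \<Longrightarrow> b x (y + y') = b x y + b x y'"
    and bi_ext_cls: "\<And>x y. x \<in> carrier G \<Longrightarrow> y \<in> carrier G \<Longrightarrow>
      cls (b (tensor_rep (cls x)) (tensor_rep (cls y))) = cls (b x y)"
proof -
  have in1: "frag_extend (\<beta> (p, q)) y \<in> carrier G"
    if "p \<in> carrier U" "q \<in> carrier Q" "y \<in> carrier G" for p q y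
    by (rule lift_closed[OF that(3)]) (use c that G_0 G_diff in blast)+
  show cl: "b x y \<in> carrier G" if "x \<in> carrier G" "y \<in> carrier G" for x y
    unfolding b_def by (rule lift_closed[OF that(1)]) (use in1 that G_0 G_diff in blast)+
  show al: "b (x + x') y = b x y + b x' y" for x x' y
    by (simp add: b_def frag_extend_add)
  have dl: "b (x - x') y = b x y - b x' y" for x x' y
    by (simp add: b_def frag_extend_diff)
  have dr: "b x (y - y') = b x y - b x y'" if "x \<in> carrier G" for x y y'
  proof -
    have "x \<in> carrier G" by fact
    then show ?thesis unfolding b_def
      by (induction x rule: G_induct) (simp_all add: frag_extend_diff)
  qed
  show ar: "b x (y + y') = b x y + b x y'" if "x \<in> carrier G" for x y y'
    using dr[OF that, of y "- y'"] dr[OF that, of 0 y'] dr[OF that, of 0 0] by simp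
  have kr: "b x y \<in> N" if "x \<in> carrier G" "y \<in> N" for x y
    unfolding b_def
  proof (rule lift_closed[OF that(1)])
    show "frag_extend (\<beta> (u, q)) y \<in> N" if "u \<in> carrier U" "q \<in> carrier Q" for u q
      by (rule lift_ker[OF \<open>y \<in> N\<close> r1 r2 r3 ker_0 ker_diff]) (assumption | rule that)+
  qed (rule ker_0 ker_diff; assumption)+
  have y3: "frag_extend f y - frag_extend g y - frag_extend h y \<in> N"
    if "y \<in> carrier G" "\<And>r s. r \<in> carrier U \<Longrightarrow> s \<in> carrier Q \<Longrightarrow> f (r, s) - g (r, s) - h (r, s) \<in> N" for f g h y
  proof -
    have "y \<in> carrier G" by fact
    then show ?thesis
    proof (induction y rule: G_induct)
      case (2 x y)
      have "frag_extend f (x - y) - frag_extend g (x - y) - frag_extend h (x - y) =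
        (frag_extend f x - frag_extend g x - frag_extend h x) - (frag_extend f y - frag_extend g y - frag_extend h y)"
        by (simp add: frag_extend_diff algebra_simps)
      then show ?case using ker_diff[OF 2(3,4)] by simp
    qed (use that ker_0 in auto)
  qed
  have y2: "frag_extend f y - frag_extend g y \<in> N"
    if "y \<in> carrier G" "\<And>r s. r \<in> carrier U \<Longrightarrow> s \<in> carrier Q \<Longrightarrow> f (r, s) - g (r, s) \<in> N" for f g y
    using y3[OF that(1), of f g "\<lambda>_. 0"] that(2) by (simp add: frag_extend_eq_0)
  have kl: "b x y \<in> N" if "x \<in> N" "y \<in> carrier G" for x y
    unfolding b_def
    by (rule lift_ker[OF that(1) y3[OF that(2)] y3[OF that(2)] y2[OF that(2)] ker_0 ker_diff])
      ((rule l1; assumption) | (rule l2; assumption) | (rule l3; assumption) | assumption)+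
  show "cls (b (tensor_rep (cls x)) (tensor_rep (cls y))) = cls (b x y)"
    if "x \<in> carrier G" "y \<in> carrier G" for x y
  proof -
    let ?x = "tensor_rep (cls x)" and ?y = "tensor_rep (cls y)"
    note X = rep_cls[OF that(1)] and Y = rep_cls[OF that(2)]
    have "b ?x ?y - b x y = b (?x - x) ?y + b x (?y - y)"
      by (simp add: dl dr[OF that(1)])
    also have "\<dots> \<in> N" by (intro ker_add kl kr X Y that)
    finally show ?thesis using cls_eq_iff cl X Y that by blast
  qed
qed

lemma pt_add_left: "u \<in> carrier U \<Longrightarrow> u' \<in> carrier U \<Longrightarrow> q \<in> carrier Q \<Longrightarrow>
    pt (u \<oplus>\<^bsub>U\<^esub> u') q = pt u q \<otimes>\<^bsub>G Mod N\<^esub> pt u' q"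
  using rel_closed(1)[of u u' q]
  by (simp add: pure_tensor_def mod_mult cls_eq_iff diff_diff_eq)

lemma pt_add_right: "u \<in> carrier U \<Longrightarrow> q \<in> carrier Q \<Longrightarrow> q' \<in> carrier Q \<Longrightarrow>
    pt u (q \<oplus>\<^bsub>Q\<^esub> q') = pt u q \<otimes>\<^bsub>G Mod N\<^esub> pt u q'"
  using rel_closed(2)[of u q q']
  by (simp add: pure_tensor_def mod_mult cls_eq_iff diff_diff_eq)

lemma pt_smult: "a \<in> carrier F \<Longrightarrow> u \<in> carrier U \<Longrightarrow> q \<in> carrier Q \<Longrightarrow>
    pt (a \<odot>\<^bsub>U\<^esub> u) q = pt u (a \<odot>\<^bsub>Q\<^esub> q)"
  using rel_closed(3)[of a u q]
  by (simp add: pure_tensor_def cls_eq_iff)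

lemma pt_closed: "u \<in> carrier U \<Longrightarrow> q \<in> carrier Q \<Longrightarrow> pt u q \<in> carrier (G Mod N)"
  by (simp add: pure_tensor_def mod_carrier)

lemma pt_zero_left: "q \<in> carrier Q \<Longrightarrow> pt \<zero>\<^bsub>U\<^esub> q = \<one>\<^bsub>G Mod N\<^esub>"
  using pt_add_left[of "\<zero>\<^bsub>U\<^esub>" "\<zero>\<^bsub>U\<^esub>" q] pt_closed[of "\<zero>\<^bsub>U\<^esub>" q]
    group.l_cancel_one'[OF comm_group.axioms(2)[OF mod_comm_group]] by simp

lemma pt_zero_right: "u \<in> carrier U \<Longrightarrow> pt u \<zero>\<^bsub>Q\<^esub> = \<one>\<^bsub>G Mod N\<^esub>"
  using pt_add_right[of u "\<zero>\<^bsub>Q\<^esub>" "\<zero>\<^bsub>Q\<^esub>"] pt_closed[of u "\<zero>\<^bsub>Q\<^esub>"]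
    group.l_cancel_one'[OF comm_group.axioms(2)[OF mod_comm_group]] by simp

lemma pt_minus: "u \<in> carrier U \<Longrightarrow> q \<in> carrier Q \<Longrightarrow> cls (- frag_of (u, q)) = pt (\<ominus>\<^bsub>U\<^esub> u) q"
proof -
  assume uq: "u \<in> carrier U" "q \<in> carrier Q"
  have z: "frag_of (\<zero>\<^bsub>U\<^esub>, q) \<in> N"
    using ker_minus[OF rel_closed(1)[of "\<zero>\<^bsub>U\<^esub>" "\<zero>\<^bsub>U\<^esub>" q]] uq by simp
  have "frag_of (\<zero>\<^bsub>U\<^esub>, q) - frag_of (u, q) - frag_of (\<ominus>\<^bsub>U\<^esub> u, q) \<in> N"
    using rel_closed(1)[of u "\<ominus>\<^bsub>U\<^esub> u" q] uq by (simp add: U.M.r_neg)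
  from ker_diff[OF this z] have "- frag_of (u, q) - frag_of (\<ominus>\<^bsub>U\<^esub> u, q) \<in> N" by simp
  then show ?thesis
    unfolding pure_tensor_def using uq by (simp add: cls_eq_iff)
qed

lemma tensor_induct_raw:
  assumes "T \<in> carrier (G Mod N)"
    and p: "\<And>u q. u \<in> carrier U \<Longrightarrow> q \<in> carrier Q \<Longrightarrow> \<Phi> (pt u q)"
    and a: "\<And>S T. S \<in> carrier (G Mod N) \<Longrightarrow> T \<in> carrier (G Mod N) \<Longrightarrow> \<Phi> S \<Longrightarrow> \<Phi> T \<Longrightarrow> \<Phi> (S \<otimes>\<^bsub>G Mod N\<^esub> T)"
  shows "\<Phi> T"
proof -
  obtain x where x: "x \<in> carrier G" "T = cls x" using assms(1) mod_carrier by auto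
  from x(1) have "\<Phi> (cls x) \<and> \<Phi> (cls (- x))"
  proof (induction x rule: G_induct)
    case 1
    show ?case using p[of "\<zero>\<^bsub>U\<^esub>" "\<zero>\<^bsub>Q\<^esub>"] pt_zero_left[of "\<zero>\<^bsub>Q\<^esub>"] mod_one by simp
  next
    case (2 x y)
    have c: "x \<in> carrier G" "y \<in> carrier G" "- x \<in> carrier G" "- y \<in> carrier G" using 2 by simp_all
    have "\<Phi> (cls x \<otimes>\<^bsub>G Mod N\<^esub> cls (- y))" "\<Phi> (cls (- x) \<otimes>\<^bsub>G Mod N\<^esub> cls y)"
      using 2 c mod_carrier by (auto intro!: a)
    then show ?case using c by (simp add: mod_mult)
  next
    case (3 u q)
    then show ?case using p pt_minus by (auto simp: pure_tensor_def)
  qed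
  then show ?thesis using x by simp
qed

end

locale two_poisson = U: poisson_algebra F U + Q: poisson_algebra F Q
  for F :: "('f, 'm) ring_scheme" and U :: "('f, 'a, 'x) poisson_scheme" and Q :: "('f, 'b, 'y) poisson_scheme"
begin

sublocale two_modules F U Q
  by (intro two_modules.intro U.module_axioms Q.module_axioms)

abbreviation "T \<equiv> tensor_product F U Q"

lemma T_carrier: "carrier T = carrier (G Mod N)" and T_add: "R \<oplus>\<^bsub>T\<^esub> S = R \<otimes>\<^bsub>G Mod N\<^esub> S"
  and T_zero: "\<zero>\<^bsub>T\<^esub> = \<one>\<^bsub>G Mod N\<^esub>"
  by (simp_all add: tensor_product_def)

lemma T_abelian: "abelian_group T"
proof -
  interpret M: comm_group "G Mod N" by (rule mod_comm_group)
  show ?thesis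
  proof (rule abelian_groupI)
    fix x assume "x \<in> carrier T"
    then show "\<exists>y\<in>carrier T. y \<oplus>\<^bsub>T\<^esub> x = \<zero>\<^bsub>T\<^esub>"
      unfolding T_carrier T_add T_zero by (intro bexI[of _ "inv\<^bsub>G Mod N\<^esub> x"]) simp_all
  qed (simp_all add: T_carrier T_add T_zero M.m_ac)
qed

sublocale T: abelian_group T by (rule T_abelian)

lemma pure_closed: "u \<in> carrier U \<Longrightarrow> q \<in> carrier Q \<Longrightarrow> pt u q \<in> carrier T"
  by (simp add: T_carrier pt_closed)

lemma pure_add_left: "u \<in> carrier U \<Longrightarrow> u' \<in> carrier U \<Longrightarrow> q \<in> carrier Q \<Longrightarrow> pt (u \<oplus>\<^bsub>U\<^esub> u') q = pt u q \<oplus>\<^bsub>T\<^esub> pt u' q"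
  by (simp add: T_add pt_add_left)

lemma pure_add_right: "u \<in> carrier U \<Longrightarrow> q \<in> carrier Q \<Longrightarrow> q' \<in> carrier Q \<Longrightarrow> pt u (q \<oplus>\<^bsub>Q\<^esub> q') = pt u q \<oplus>\<^bsub>T\<^esub> pt u q'"
  by (simp add: T_add pt_add_right)

lemma pure_zero_left: "q \<in> carrier Q \<Longrightarrow> pt \<zero>\<^bsub>U\<^esub> q = \<zero>\<^bsub>T\<^esub>"
  and pure_zero_right: "u \<in> carrier U \<Longrightarrow> pt u \<zero>\<^bsub>Q\<^esub> = \<zero>\<^bsub>T\<^esub>"
  by (simp_all add: T_zero pt_zero_left pt_zero_right)

lemma tensor_induct [consumes 1, case_names pure add]:
  assumes "R \<in> carrier T"
    and "\<And>u q. u \<in> carrier U \<Longrightarrow> q \<in> carrier Q \<Longrightarrow> \<Phi> (pt u q)"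
    and "\<And>R S. R \<in> carrier T \<Longrightarrow> S \<in> carrier T \<Longrightarrow> \<Phi> R \<Longrightarrow> \<Phi> S \<Longrightarrow> \<Phi> (R \<oplus>\<^bsub>T\<^esub> S)"
  shows "\<Phi> R"
  using assms unfolding T_carrier T_add by (rule tensor_induct_raw)

lemma T_cases: "R \<in> carrier T \<Longrightarrow> (\<And>x. x \<in> carrier G \<Longrightarrow> R = cls x \<Longrightarrow> thesis) \<Longrightarrow> thesis"
  unfolding T_carrier mod_carrier by blast

lemma cls_closed: "x \<in> carrier G \<Longrightarrow> cls x \<in> carrier T"
  unfolding T_carrier mod_carrier by blast

lemma cls_add: "x \<in> carrier G \<Longrightarrow> y \<in> carrier G \<Longrightarrow> cls x \<oplus>\<^bsub>T\<^esub> cls y = cls (x + y)"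
  unfolding T_add by (rule mod_mult)

lemma pt_cls: "pt u q = cls (frag_of (u, q))" by (simp add: pure_tensor_def)

lemma smult_frag:
  assumes a: "a \<in> carrier F" and x: "x \<in> carrier G"
  shows "frag_smult U a x \<in> carrier G"
    and "a \<odot>\<^bsub>T\<^esub> cls x = cls (frag_smult U a x)"
proof -
  have c: "frag_smult U a x \<in> carrier G" if "x \<in> carrier G" for x
    unfolding frag_smult_def by (rule lift_closed[OF that _ G_0 G_diff]) (use a in simp_all)
  then show "frag_smult U a x \<in> carrier G" using x .
  have k: "frag_smult U a x \<in> N" if "x \<in> N" for x
    unfolding frag_smult_def
  proof (rule lift_ker[OF that _ _ _ ker_0 ker_diff])
    fix b u q assume "b \<in> carrier F" "u \<in> carrier U" "q \<in> carrier Q"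
    moreover have "a \<odot>\<^bsub>U\<^esub> (b \<odot>\<^bsub>U\<^esub> u) = b \<odot>\<^bsub>U\<^esub> (a \<odot>\<^bsub>U\<^esub> u)"
      using calculation a by (metis U.R.m_comm U.smult_assoc1)
    ultimately show "(case (b \<odot>\<^bsub>U\<^esub> u, q) of (u, q) \<Rightarrow> frag_of (a \<odot>\<^bsub>U\<^esub> u, q)) -
        (case (u, b \<odot>\<^bsub>Q\<^esub> q) of (u, q) \<Rightarrow> frag_of (a \<odot>\<^bsub>U\<^esub> u, q)) \<in> N"
      using rel_closed(3)[of b "a \<odot>\<^bsub>U\<^esub> u" q] a by simp
  qed (use a rel_closed(1,2) in \<open>simp_all add: U.smult_r_distr\<close>)
  show "a \<odot>\<^bsub>T\<^esub> cls x = cls (frag_smult U a x)"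
    using k[OF rep_cls(2)[OF x]]
    by (simp add: tensor_product_def cls_eq_iff frag_smult_def frag_extend_diff)
qed

lemma smult_pure: "a \<in> carrier F \<Longrightarrow> u \<in> carrier U \<Longrightarrow> q \<in> carrier Q \<Longrightarrow> a \<odot>\<^bsub>T\<^esub> pt u q = pt (a \<odot>\<^bsub>U\<^esub> u) q"
  by (simp add: pt_cls smult_frag(2)) (simp add: frag_smult_def)

lemma smult_pure': "a \<in> carrier F \<Longrightarrow> u \<in> carrier U \<Longrightarrow> q \<in> carrier Q \<Longrightarrow> a \<odot>\<^bsub>T\<^esub> pt u q = pt u (a \<odot>\<^bsub>Q\<^esub> q)"
  by (simp add: smult_pure pt_smult)

lemma smult_T_closed: "a \<in> carrier F \<Longrightarrow> R \<in> carrier T \<Longrightarrow> a \<odot>\<^bsub>T\<^esub> R \<in> carrier T"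
  by (elim T_cases) (simp only: smult_frag cls_closed)

lemma smult_T_add: "a \<in> carrier F \<Longrightarrow> R \<in> carrier T \<Longrightarrow> S \<in> carrier T \<Longrightarrow>
    a \<odot>\<^bsub>T\<^esub> (R \<oplus>\<^bsub>T\<^esub> S) = a \<odot>\<^bsub>T\<^esub> R \<oplus>\<^bsub>T\<^esub> a \<odot>\<^bsub>T\<^esub> S"
  by (elim T_cases) (simp only: cls_add smult_frag G_add, simp add: frag_smult_def frag_extend_add)

lemma T_module: "module F T"
proof (rule moduleI)
  show "cring F" by (rule U.R_cring)
  fix a b R S assume a: "a \<in> carrier F" and b: "b \<in> carrier F" and R: "R \<in> carrier T"
  show "(a \<oplus>\<^bsub>F\<^esub> b) \<odot>\<^bsub>T\<^esub> R = a \<odot>\<^bsub>T\<^esub> R \<oplus>\<^bsub>T\<^esub> b \<odot>\<^bsub>T\<^esub> R"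
    using R
  proof (induction R rule: tensor_induct)
    case (pure u q) then show ?case using a b by (simp add: smult_pure U.smult_l_distr pure_add_left)
  next
    case (add R S) then show ?case using a b by (simp add: smult_T_add smult_T_closed T.a_ac)
  qed
  show "(a \<otimes>\<^bsub>F\<^esub> b) \<odot>\<^bsub>T\<^esub> R = a \<odot>\<^bsub>T\<^esub> (b \<odot>\<^bsub>T\<^esub> R)"
    using R
  proof (induction R rule: tensor_induct)
    case (pure u q) then show ?case using a b by (simp add: smult_pure U.smult_assoc1)
  next
    case (add R S) then show ?case using a b by (simp add: smult_T_add smult_T_closed)
  qed
next
  fix R assume R: "R \<in> carrier T"
  show "\<one>\<^bsub>F\<^esub> \<odot>\<^bsub>T\<^esub> R = R"
    using R by (induction R rule: tensor_induct) (simp_all add: smult_pure smult_T_add)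
qed (use T_abelian smult_T_closed smult_T_add in auto)

abbreviation "\<mu> \<equiv> \<lambda>(p, q) (r, s). frag_of (p \<otimes>\<^bsub>U\<^esub> r, q \<otimes>\<^bsub>Q\<^esub> s)"
abbreviation "lb \<equiv> \<lambda>(p, q) (r, s). frag_of (p \<otimes>\<^bsub>U\<^esub> r, \<lbrace>q, s\<rbrace>\<^bsub>Q\<^esub>) + frag_of (\<lbrace>p, r\<rbrace>\<^bsub>U\<^esub>, q \<otimes>\<^bsub>Q\<^esub> s)"

lemma frag_mult_eq: "frag_mult U Q x y = frag_extend (\<lambda>i. frag_extend (\<mu> i) y) x"
  unfolding frag_mult_def by (simp add: case_prod_beta')

lemma frag_bracket_eq: "frag_bracket U Q x y = frag_extend (\<lambda>i. frag_extend (lb i) y) x"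
  unfolding frag_bracket_def by (simp add: case_prod_beta')

lemma U_smult_right: "a \<in> carrier F \<Longrightarrow> x \<in> carrier U \<Longrightarrow> y \<in> carrier U \<Longrightarrow> x \<otimes>\<^bsub>U\<^esub> (a \<odot>\<^bsub>U\<^esub> y) = a \<odot>\<^bsub>U\<^esub> (x \<otimes>\<^bsub>U\<^esub> y)"
  by (metis U.m_comm U.smult_assoc2 U.smult_closed)
lemma Q_smult_right: "a \<in> carrier F \<Longrightarrow> x \<in> carrier Q \<Longrightarrow> y \<in> carrier Q \<Longrightarrow> x \<otimes>\<^bsub>Q\<^esub> (a \<odot>\<^bsub>Q\<^esub> y) = a \<odot>\<^bsub>Q\<^esub> (x \<otimes>\<^bsub>Q\<^esub> y)"
  by (metis Q.m_comm Q.smult_assoc2 Q.smult_closed)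

lemmas U_simps = U.l_distr U.r_distr U.smult_assoc2 U_smult_right U.bracket_add_left U.bracket_add_right
  U.bracket_smult_left U.bracket_smult_right U.bracket_closed
lemmas Q_simps = Q.l_distr Q.r_distr Q.smult_assoc2 Q_smult_right Q.bracket_add_left Q.bracket_add_right
  Q.bracket_smult_left Q.bracket_smult_right Q.bracket_closed

lemma ker_split3: "a - b - c \<in> N \<Longrightarrow> a' - b' - c' \<in> N \<Longrightarrow> a + a' - (b + b') - (c + c') \<in> N"
  using ker_add[of "a - b - c" "a' - b' - c'"] by (simp add: algebra_simps)
lemma ker_split2: "a - b \<in> N \<Longrightarrow> a' - b' \<in> N \<Longrightarrow> a + a' - (b + b') \<in> N"
  using ker_add[of "a - b" "a' - b'"] by (simp add: algebra_simps)

lemma mult_frag: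
  shows mult_frag_closed: "\<And>x y. x \<in> carrier G \<Longrightarrow> y \<in> carrier G \<Longrightarrow> frag_mult U Q x y \<in> carrier G"
    and mult_frag_add_left: "\<And>x x' y. frag_mult U Q (x + x') y = frag_mult U Q x y + frag_mult U Q x' y"
    and mult_frag_add_right: "\<And>x y y'. x \<in> carrier G \<Longrightarrow> frag_mult U Q x (y + y') = frag_mult U Q x y + frag_mult U Q x y'"
    and mult_frag_cls: "\<And>x y. x \<in> carrier G \<Longrightarrow> y \<in> carrier G \<Longrightarrow> cls x \<otimes>\<^bsub>T\<^esub> cls y = cls (frag_mult U Q x y)"
proof -
  have c: "\<And>p q r s. p \<in> carrier U \<Longrightarrow> q \<in> carrier Q \<Longrightarrow> r \<in> carrier U \<Longrightarrow> s \<in> carrier Q \<Longrightarrow> \<mu> (p, q) (r, s) \<in> carrier G"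
    by simp
  have l1: "\<And>p p' q r s. p \<in> carrier U \<Longrightarrow> p' \<in> carrier U \<Longrightarrow> q \<in> carrier Q \<Longrightarrow> r \<in> carrier U \<Longrightarrow> s \<in> carrier Q \<Longrightarrow> \<mu> (p \<oplus>\<^bsub>U\<^esub> p', q) (r, s) - \<mu> (p, q) (r, s) - \<mu> (p', q) (r, s) \<in> N"
    by (simp only: prod.case U_simps Q_simps, rule rel_closed(1)) simp_all
  have l2: "\<And>p q q' r s. p \<in> carrier U \<Longrightarrow> q \<in> carrier Q \<Longrightarrow> q' \<in> carrier Q \<Longrightarrow> r \<in> carrier U \<Longrightarrow> s \<in> carrier Q \<Longrightarrow> \<mu> (p, q \<oplus>\<^bsub>Q\<^esub> q') (r, s) - \<mu> (p, q) (r, s) - \<mu> (p, q') (r, s) \<in> N"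
    by (simp only: prod.case U_simps Q_simps, rule rel_closed(2)) simp_all
  have l3: "\<And>a p q r s. a \<in> carrier F \<Longrightarrow> p \<in> carrier U \<Longrightarrow> q \<in> carrier Q \<Longrightarrow> r \<in> carrier U \<Longrightarrow> s \<in> carrier Q \<Longrightarrow> \<mu> (a \<odot>\<^bsub>U\<^esub> p, q) (r, s) - \<mu> (p, a \<odot>\<^bsub>Q\<^esub> q) (r, s) \<in> N"
    by (simp only: prod.case U_simps Q_simps, rule rel_closed(3)) simp_all
  have r1: "\<And>p q r r' s. p \<in> carrier U \<Longrightarrow> q \<in> carrier Q \<Longrightarrow> r \<in> carrier U \<Longrightarrow> r' \<in> carrier U \<Longrightarrow> s \<in> carrier Q \<Longrightarrow> \<mu> (p, q) (r \<oplus>\<^bsub>U\<^esub> r', s) - \<mu> (p, q) (r, s) - \<mu> (p, q) (r', s) \<in> N"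
    by (simp only: prod.case U_simps Q_simps, rule rel_closed(1)) simp_all
  have r2: "\<And>p q r s s'. p \<in> carrier U \<Longrightarrow> q \<in> carrier Q \<Longrightarrow> r \<in> carrier U \<Longrightarrow> s \<in> carrier Q \<Longrightarrow> s' \<in> carrier Q \<Longrightarrow> \<mu> (p, q) (r, s \<oplus>\<^bsub>Q\<^esub> s') - \<mu> (p, q) (r, s) - \<mu> (p, q) (r, s') \<in> N"
    by (simp only: prod.case U_simps Q_simps, rule rel_closed(2)) simp_all
  have r3: "\<And>a p q r s. a \<in> carrier F \<Longrightarrow> p \<in> carrier U \<Longrightarrow> q \<in> carrier Q \<Longrightarrow> r \<in> carrier U \<Longrightarrow> s \<in> carrier Q \<Longrightarrow> \<mu> (p, q) (a \<odot>\<^bsub>U\<^esub> r, s) - \<mu> (p, q) (r, a \<odot>\<^bsub>Q\<^esub> s) \<in> N"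
    by (simp only: prod.case U_simps Q_simps, rule rel_closed(3)) simp_all
  note * = bi_ext[of \<mu>, OF c l1 l2 l3 r1 r2 r3, folded frag_mult_eq]
  show "\<And>x y. x \<in> carrier G \<Longrightarrow> y \<in> carrier G \<Longrightarrow> frag_mult U Q x y \<in> carrier G" by (rule *(1))
  show "\<And>x x' y. frag_mult U Q (x + x') y = frag_mult U Q x y + frag_mult U Q x' y" by (rule *(2))
  show "\<And>x y y'. x \<in> carrier G \<Longrightarrow> frag_mult U Q x (y + y') = frag_mult U Q x y + frag_mult U Q x y'" by (rule *(3))
  show "\<And>x y. x \<in> carrier G \<Longrightarrow> y \<in> carrier G \<Longrightarrow> cls x \<otimes>\<^bsub>T\<^esub> cls y = cls (frag_mult U Q x y)"
    using *(4) by (simp add: tensor_product_def)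
qed

lemma bracket_frag:
  shows bracket_frag_closed: "\<And>x y. x \<in> carrier G \<Longrightarrow> y \<in> carrier G \<Longrightarrow> frag_bracket U Q x y \<in> carrier G"
    and bracket_frag_add_left: "\<And>x x' y. frag_bracket U Q (x + x') y = frag_bracket U Q x y + frag_bracket U Q x' y"
    and bracket_frag_add_right: "\<And>x y y'. x \<in> carrier G \<Longrightarrow> frag_bracket U Q x (y + y') = frag_bracket U Q x y + frag_bracket U Q x y'"
    and bracket_frag_cls: "\<And>x y. x \<in> carrier G \<Longrightarrow> y \<in> carrier G \<Longrightarrow> \<lbrace>cls x, cls y\<rbrace>\<^bsub>T\<^esub> = cls (frag_bracket U Q x y)"
proof -
  have c: "\<And>p q r s. p \<in> carrier U \<Longrightarrow> q \<in> carrier Q \<Longrightarrow> r \<in> carrier U \<Longrightarrow> s \<in> carrier Q \<Longrightarrow> lb (p, q) (r, s) \<in> carrier G"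
    using G_add by (simp add: U.bracket_closed Q.bracket_closed)
  have l1: "\<And>p p' q r s. p \<in> carrier U \<Longrightarrow> p' \<in> carrier U \<Longrightarrow> q \<in> carrier Q \<Longrightarrow> r \<in> carrier U \<Longrightarrow> s \<in> carrier Q \<Longrightarrow> lb (p \<oplus>\<^bsub>U\<^esub> p', q) (r, s) - lb (p, q) (r, s) - lb (p', q) (r, s) \<in> N"
    by (simp only: prod.case U_simps Q_simps, rule ker_split3; rule rel_closed(1)) (simp_all add: U_simps Q_simps)
  have l2: "\<And>p q q' r s. p \<in> carrier U \<Longrightarrow> q \<in> carrier Q \<Longrightarrow> q' \<in> carrier Q \<Longrightarrow> r \<in> carrier U \<Longrightarrow> s \<in> carrier Q \<Longrightarrow> lb (p, q \<oplus>\<^bsub>Q\<^esub> q') (r, s) - lb (p, q) (r, s) - lb (p, q') (r, s) \<in> N"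
    by (simp only: prod.case U_simps Q_simps, rule ker_split3; rule rel_closed(2)) (simp_all add: U_simps Q_simps)
  have l3: "\<And>a p q r s. a \<in> carrier F \<Longrightarrow> p \<in> carrier U \<Longrightarrow> q \<in> carrier Q \<Longrightarrow> r \<in> carrier U \<Longrightarrow> s \<in> carrier Q \<Longrightarrow> lb (a \<odot>\<^bsub>U\<^esub> p, q) (r, s) - lb (p, a \<odot>\<^bsub>Q\<^esub> q) (r, s) \<in> N"
    by (simp only: prod.case U_simps Q_simps, rule ker_split2; rule rel_closed(3)) (simp_all add: U_simps Q_simps)
  have r1: "\<And>p q r r' s. p \<in> carrier U \<Longrightarrow> q \<in> carrier Q \<Longrightarrow> r \<in> carrier U \<Longrightarrow> r' \<in> carrier U \<Longrightarrow> s \<in> carrier Q \<Longrightarrow> lb (p, q) (r \<oplus>\<^bsub>U\<^esub> r', s) - lb (p, q) (r, s) - lb (p, q) (r', s) \<in> N"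
    by (simp only: prod.case U_simps Q_simps, rule ker_split3; rule rel_closed(1)) (simp_all add: U_simps Q_simps)
  have r2: "\<And>p q r s s'. p \<in> carrier U \<Longrightarrow> q \<in> carrier Q \<Longrightarrow> r \<in> carrier U \<Longrightarrow> s \<in> carrier Q \<Longrightarrow> s' \<in> carrier Q \<Longrightarrow> lb (p, q) (r, s \<oplus>\<^bsub>Q\<^esub> s') - lb (p, q) (r, s) - lb (p, q) (r, s') \<in> N"
    by (simp only: prod.case U_simps Q_simps, rule ker_split3; rule rel_closed(2)) (simp_all add: U_simps Q_simps)
  have r3: "\<And>a p q r s. a \<in> carrier F \<Longrightarrow> p \<in> carrier U \<Longrightarrow> q \<in> carrier Q \<Longrightarrow> r \<in> carrier U \<Longrightarrow> s \<in> carrier Q \<Longrightarrow> lb (p, q) (a \<odot>\<^bsub>U\<^esub> r, s) - lb (p, q) (r, a \<odot>\<^bsub>Q\<^esub> s) \<in> N"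
    by (simp only: prod.case U_simps Q_simps, rule ker_split2; rule rel_closed(3)) (simp_all add: U_simps Q_simps)
  note * = bi_ext[of lb, OF c l1 l2 l3 r1 r2 r3, folded frag_bracket_eq]
  show "\<And>x y. x \<in> carrier G \<Longrightarrow> y \<in> carrier G \<Longrightarrow> frag_bracket U Q x y \<in> carrier G" by (rule *(1))
  show "\<And>x x' y. frag_bracket U Q (x + x') y = frag_bracket U Q x y + frag_bracket U Q x' y" by (rule *(2))
  show "\<And>x y y'. x \<in> carrier G \<Longrightarrow> frag_bracket U Q x (y + y') = frag_bracket U Q x y + frag_bracket U Q x y'" by (rule *(3))
  show "\<And>x y. x \<in> carrier G \<Longrightarrow> y \<in> carrier G \<Longrightarrow> \<lbrace>cls x, cls y\<rbrace>\<^bsub>T\<^esub> = cls (frag_bracket U Q x y)"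
    using *(4) by (simp add: tensor_product_def)
qed


lemma mult_pure:
  "p \<in> carrier U \<Longrightarrow> q \<in> carrier Q \<Longrightarrow> r \<in> carrier U \<Longrightarrow> s \<in> carrier Q \<Longrightarrow>
    pt p q \<otimes>\<^bsub>T\<^esub> pt r s = pt (p \<otimes>\<^bsub>U\<^esub> r) (q \<otimes>\<^bsub>Q\<^esub> s)"
  by (simp add: pt_cls mult_frag_cls) (simp add: frag_mult_def)

lemma bracket_pure:
  "p \<in> carrier U \<Longrightarrow> q \<in> carrier Q \<Longrightarrow> r \<in> carrier U \<Longrightarrow> s \<in> carrier Q \<Longrightarrow>
    \<lbrace>pt p q, pt r s\<rbrace>\<^bsub>T\<^esub> = pt (p \<otimes>\<^bsub>U\<^esub> r) \<lbrace>q, s\<rbrace>\<^bsub>Q\<^esub> \<oplus>\<^bsub>T\<^esub> pt \<lbrace>p, r\<rbrace>\<^bsub>U\<^esub> (q \<otimes>\<^bsub>Q\<^esub> s)"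
  by (simp add: pt_cls bracket_frag_cls cls_add U.bracket_closed Q.bracket_closed) (simp add: frag_bracket_def)

lemma mult_T:
  assumes "R \<in> carrier T" "S \<in> carrier T"
  shows mult_T_closed: "R \<otimes>\<^bsub>T\<^esub> S \<in> carrier T"
    and mult_T_add_left: "R' \<in> carrier T \<Longrightarrow> (R \<oplus>\<^bsub>T\<^esub> R') \<otimes>\<^bsub>T\<^esub> S = R \<otimes>\<^bsub>T\<^esub> S \<oplus>\<^bsub>T\<^esub> R' \<otimes>\<^bsub>T\<^esub> S"
    and mult_T_add_right: "R' \<in> carrier T \<Longrightarrow> R \<otimes>\<^bsub>T\<^esub> (S \<oplus>\<^bsub>T\<^esub> R') = R \<otimes>\<^bsub>T\<^esub> S \<oplus>\<^bsub>T\<^esub> R \<otimes>\<^bsub>T\<^esub> R'"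
  using assms
  by - (elim T_cases; simp only: cls_add mult_frag_cls cls_closed mult_frag_closed G_add mult_frag_add_left mult_frag_add_right)+

lemma bracket_T:
  assumes "R \<in> carrier T" "S \<in> carrier T"
  shows bracket_T_closed: "\<lbrace>R, S\<rbrace>\<^bsub>T\<^esub> \<in> carrier T"
    and bracket_T_add_left: "R' \<in> carrier T \<Longrightarrow> \<lbrace>R \<oplus>\<^bsub>T\<^esub> R', S\<rbrace>\<^bsub>T\<^esub> = \<lbrace>R, S\<rbrace>\<^bsub>T\<^esub> \<oplus>\<^bsub>T\<^esub> \<lbrace>R', S\<rbrace>\<^bsub>T\<^esub>"
    and bracket_T_add_right: "R' \<in> carrier T \<Longrightarrow> \<lbrace>R, S \<oplus>\<^bsub>T\<^esub> R'\<rbrace>\<^bsub>T\<^esub> = \<lbrace>R, S\<rbrace>\<^bsub>T\<^esub> \<oplus>\<^bsub>T\<^esub> \<lbrace>R, R'\<rbrace>\<^bsub>T\<^esub>"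
  using assms
  by - (elim T_cases; simp only: cls_add bracket_frag_cls cls_closed bracket_frag_closed G_add bracket_frag_add_left bracket_frag_add_right)+

lemma one_T: "\<one>\<^bsub>T\<^esub> = pt \<one>\<^bsub>U\<^esub> \<one>\<^bsub>Q\<^esub>"
  by (simp add: tensor_product_def)

lemmas cl = mult_T_closed bracket_T_closed smult_T_closed pure_closed U.bracket_closed Q.bracket_closed
lemmas addT = mult_T_add_left mult_T_add_right bracket_T_add_left bracket_T_add_right smult_T_add

lemma T_cring: "cring T"
proof (rule cringI)
  show "abelian_group T" by (rule T_abelian)
  have comm: "R \<otimes>\<^bsub>T\<^esub> S = S \<otimes>\<^bsub>T\<^esub> R" if "R \<in> carrier T" "S \<in> carrier T" for R S
    using that
  proof (induction R rule: tensor_induct)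
    case (pure p q)
    from pure(3) show ?case
    proof (induction S rule: tensor_induct)
      case (pure r s)
      then show ?case using \<open>p \<in> carrier U\<close> \<open>q \<in> carrier Q\<close> by (simp add: mult_pure U.m_comm Q.m_comm)
    next
      case (add R S)
      then show ?case using \<open>p \<in> carrier U\<close> \<open>q \<in> carrier Q\<close> by (simp add: addT cl)
    qed
  next
    case (add R R')
    then show ?case by (simp add: addT cl)
  qed
  have assoc: "R \<otimes>\<^bsub>T\<^esub> S \<otimes>\<^bsub>T\<^esub> V = R \<otimes>\<^bsub>T\<^esub> (S \<otimes>\<^bsub>T\<^esub> V)"
    if "R \<in> carrier T" "S \<in> carrier T" "V \<in> carrier T" for R S V
    using that
  proof (induction R rule: tensor_induct)
    case R: (pure p q)
    from R(3,4) show ?case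
    proof (induction S rule: tensor_induct)
      case S: (pure r s)
      from S(3) show ?case
      proof (induction V rule: tensor_induct)
        case (pure t v)
        then show ?case using R S by (simp add: mult_pure U.m_assoc Q.m_assoc)
      qed (use R S in \<open>simp add: addT cl\<close>)
    qed (use R in \<open>simp add: addT cl\<close>)
  qed (simp add: addT cl)
  have one: "\<one>\<^bsub>T\<^esub> \<otimes>\<^bsub>T\<^esub> R = R" if "R \<in> carrier T" for R
    using that by (induction R rule: tensor_induct) (simp_all add: one_T mult_pure addT cl)
  show "comm_monoid T"
    by (rule comm_monoidI) (use comm assoc one in \<open>simp_all add: cl one_T\<close>)
  show "(R \<oplus>\<^bsub>T\<^esub> S) \<otimes>\<^bsub>T\<^esub> V = R \<otimes>\<^bsub>T\<^esub> V \<oplus>\<^bsub>T\<^esub> S \<otimes>\<^bsub>T\<^esub> V"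
    if "R \<in> carrier T" "S \<in> carrier T" "V \<in> carrier T" for R S V
    using that by (simp add: addT)
qed

sublocale T: module F T by (rule T_module)
sublocale T: cring T by (rule T_cring)

lemma T_algebra: "algebra F T"
proof (rule algebra.intro)
  show "algebra_axioms F T"
  proof
    fix a R S assume a: "a \<in> carrier F" and RS: "R \<in> carrier T" "S \<in> carrier T"
    from RS show "(a \<odot>\<^bsub>T\<^esub> R) \<otimes>\<^bsub>T\<^esub> S = a \<odot>\<^bsub>T\<^esub> (R \<otimes>\<^bsub>T\<^esub> S)"
    proof (induction R rule: tensor_induct)
      case R: (pure p q)
      from R(3) show ?case
      proof (induction S rule: tensor_induct)
        case (pure r s)
        then show ?case using a R by (simp add: mult_pure smult_pure U.smult_assoc2)
      qed (use a R in \<open>simp add: addT cl\<close>)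
    qed (use a in \<open>simp add: addT cl\<close>)
  qed
qed (rule T_module T_cring)+

sublocale T: algebra F T by (rule T_algebra)

lemma U_anti: "x \<in> carrier U \<Longrightarrow> y \<in> carrier U \<Longrightarrow> \<lbrace>x, y\<rbrace>\<^bsub>U\<^esub> \<oplus>\<^bsub>U\<^esub> \<lbrace>y, x\<rbrace>\<^bsub>U\<^esub> = \<zero>\<^bsub>U\<^esub>"
proof -
  assume xy: "x \<in> carrier U" "y \<in> carrier U"
  have "\<zero>\<^bsub>U\<^esub> = \<lbrace>x \<oplus>\<^bsub>U\<^esub> y, x \<oplus>\<^bsub>U\<^esub> y\<rbrace>\<^bsub>U\<^esub>" using xy by (simp add: U.bracket_self)
  also have "\<dots> = (\<lbrace>x, x\<rbrace>\<^bsub>U\<^esub> \<oplus>\<^bsub>U\<^esub> \<lbrace>x, y\<rbrace>\<^bsub>U\<^esub>) \<oplus>\<^bsub>U\<^esub> (\<lbrace>y, x\<rbrace>\<^bsub>U\<^esub> \<oplus>\<^bsub>U\<^esub> \<lbrace>y, y\<rbrace>\<^bsub>U\<^esub>)"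
    using xy by (simp add: U.bracket_add_left U.bracket_add_right U.bracket_closed U.M.a_ac)
  also have "\<dots> = \<lbrace>x, y\<rbrace>\<^bsub>U\<^esub> \<oplus>\<^bsub>U\<^esub> \<lbrace>y, x\<rbrace>\<^bsub>U\<^esub>"
    using xy by (simp add: U.bracket_self U.bracket_closed)
  finally show ?thesis by simp
qed
lemma Q_anti: "x \<in> carrier Q \<Longrightarrow> y \<in> carrier Q \<Longrightarrow> \<lbrace>x, y\<rbrace>\<^bsub>Q\<^esub> \<oplus>\<^bsub>Q\<^esub> \<lbrace>y, x\<rbrace>\<^bsub>Q\<^esub> = \<zero>\<^bsub>Q\<^esub>"
proof -
  assume xy: "x \<in> carrier Q" "y \<in> carrier Q"
  have "\<zero>\<^bsub>Q\<^esub> = \<lbrace>x \<oplus>\<^bsub>Q\<^esub> y, x \<oplus>\<^bsub>Q\<^esub> y\<rbrace>\<^bsub>Q\<^esub>" using xy by (simp add: Q.bracket_self)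
  also have "\<dots> = (\<lbrace>x, x\<rbrace>\<^bsub>Q\<^esub> \<oplus>\<^bsub>Q\<^esub> \<lbrace>x, y\<rbrace>\<^bsub>Q\<^esub>) \<oplus>\<^bsub>Q\<^esub> (\<lbrace>y, x\<rbrace>\<^bsub>Q\<^esub> \<oplus>\<^bsub>Q\<^esub> \<lbrace>y, y\<rbrace>\<^bsub>Q\<^esub>)"
    using xy by (simp add: Q.bracket_add_left Q.bracket_add_right Q.bracket_closed Q.M.a_ac)
  also have "\<dots> = \<lbrace>x, y\<rbrace>\<^bsub>Q\<^esub> \<oplus>\<^bsub>Q\<^esub> \<lbrace>y, x\<rbrace>\<^bsub>Q\<^esub>"
    using xy by (simp add: Q.bracket_self Q.bracket_closed)
  finally show ?thesis by simp
qed

lemma T_anti: "R \<in> carrier T \<Longrightarrow> S \<in> carrier T \<Longrightarrow> \<lbrace>R, S\<rbrace>\<^bsub>T\<^esub> \<oplus>\<^bsub>T\<^esub> \<lbrace>S, R\<rbrace>\<^bsub>T\<^esub> = \<zero>\<^bsub>T\<^esub>"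
proof (induction R rule: tensor_induct)
  case R: (pure p q)
  from R(3) show ?case
  proof (induction S rule: tensor_induct)
    case S: (pure r s)
    have "\<lbrace>pt p q, pt r s\<rbrace>\<^bsub>T\<^esub> \<oplus>\<^bsub>T\<^esub> \<lbrace>pt r s, pt p q\<rbrace>\<^bsub>T\<^esub> =
      (pt (p \<otimes>\<^bsub>U\<^esub> r) \<lbrace>q, s\<rbrace>\<^bsub>Q\<^esub> \<oplus>\<^bsub>T\<^esub> pt (p \<otimes>\<^bsub>U\<^esub> r) \<lbrace>s, q\<rbrace>\<^bsub>Q\<^esub>) \<oplus>\<^bsub>T\<^esub>
      (pt \<lbrace>p, r\<rbrace>\<^bsub>U\<^esub> (q \<otimes>\<^bsub>Q\<^esub> s) \<oplus>\<^bsub>T\<^esub> pt \<lbrace>r, p\<rbrace>\<^bsub>U\<^esub> (q \<otimes>\<^bsub>Q\<^esub> s))"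
      using R S by (simp add: bracket_pure cl T.a_ac U.m_comm Q.m_comm)
    also have "\<dots> = \<zero>\<^bsub>T\<^esub>"
      using R S by (simp add: cl U_anti Q_anti pure_zero_left pure_zero_right
          pure_add_left[symmetric] pure_add_right[symmetric])
    finally show ?case .
  next
    case (add S S')
    have "\<lbrace>pt p q, S \<oplus>\<^bsub>T\<^esub> S'\<rbrace>\<^bsub>T\<^esub> \<oplus>\<^bsub>T\<^esub> \<lbrace>S \<oplus>\<^bsub>T\<^esub> S', pt p q\<rbrace>\<^bsub>T\<^esub> =
      (\<lbrace>pt p q, S\<rbrace>\<^bsub>T\<^esub> \<oplus>\<^bsub>T\<^esub> \<lbrace>S, pt p q\<rbrace>\<^bsub>T\<^esub>) \<oplus>\<^bsub>T\<^esub> (\<lbrace>pt p q, S'\<rbrace>\<^bsub>T\<^esub> \<oplus>\<^bsub>T\<^esub> \<lbrace>S', pt p q\<rbrace>\<^bsub>T\<^esub>)"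
      using add R by (simp add: addT cl T.a_ac)
    then show ?case using add by simp
  qed
next
  case (add R R')
  have "\<lbrace>R \<oplus>\<^bsub>T\<^esub> R', S\<rbrace>\<^bsub>T\<^esub> \<oplus>\<^bsub>T\<^esub> \<lbrace>S, R \<oplus>\<^bsub>T\<^esub> R'\<rbrace>\<^bsub>T\<^esub> =
    (\<lbrace>R, S\<rbrace>\<^bsub>T\<^esub> \<oplus>\<^bsub>T\<^esub> \<lbrace>S, R\<rbrace>\<^bsub>T\<^esub>) \<oplus>\<^bsub>T\<^esub> (\<lbrace>R', S\<rbrace>\<^bsub>T\<^esub> \<oplus>\<^bsub>T\<^esub> \<lbrace>S, R'\<rbrace>\<^bsub>T\<^esub>)"
    using add by (simp add: addT cl T.a_ac)
  then show ?case using add by simp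
qed

lemma T_smult_left: "R \<in> carrier T \<Longrightarrow> S \<in> carrier T \<Longrightarrow> a \<in> carrier F \<Longrightarrow> \<lbrace>a \<odot>\<^bsub>T\<^esub> R, S\<rbrace>\<^bsub>T\<^esub> = a \<odot>\<^bsub>T\<^esub> \<lbrace>R, S\<rbrace>\<^bsub>T\<^esub>"
proof (induction R rule: tensor_induct)
  case R: (pure p q)
  from R(3) show ?case
  proof (induction S rule: tensor_induct)
    case (pure r s)
    then show ?case using R
      by (simp add: bracket_pure smult_pure smult_T_add cl U.smult_assoc2 U.bracket_smult_left)
  qed (use R in \<open>simp add: addT cl\<close>)
qed (simp add: addT cl)

lemma T_smult_right: "R \<in> carrier T \<Longrightarrow> S \<in> carrier T \<Longrightarrow> a \<in> carrier F \<Longrightarrow> \<lbrace>R, a \<odot>\<^bsub>T\<^esub> S\<rbrace>\<^bsub>T\<^esub> = a \<odot>\<^bsub>T\<^esub> \<lbrace>R, S\<rbrace>\<^bsub>T\<^esub>"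
proof (induction R rule: tensor_induct)
  case R: (pure p q)
  from R(3) show ?case
  proof (induction S rule: tensor_induct)
    case (pure r s)
    then show ?case using R
      by (simp add: bracket_pure smult_pure smult_T_add cl U_smult_right U.bracket_smult_right)
  qed (use R in \<open>simp add: addT cl\<close>)
qed (simp add: addT cl)

lemma T_self: "R \<in> carrier T \<Longrightarrow> \<lbrace>R, R\<rbrace>\<^bsub>T\<^esub> = \<zero>\<^bsub>T\<^esub>"
proof (induction R rule: tensor_induct)
  case (pure p q)
  then show ?case by (simp add: bracket_pure U.bracket_self Q.bracket_self pure_zero_left pure_zero_right)
next
  case (add R S)
  then show ?case using T_anti[of S R] by (simp add: addT cl)
qed

lemma T_leibniz: "R \<in> carrier T \<Longrightarrow> S \<in> carrier T \<Longrightarrow> V \<in> carrier T \<Longrightarrow>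
  \<lbrace>R, S \<otimes>\<^bsub>T\<^esub> V\<rbrace>\<^bsub>T\<^esub> = \<lbrace>R, S\<rbrace>\<^bsub>T\<^esub> \<otimes>\<^bsub>T\<^esub> V \<oplus>\<^bsub>T\<^esub> S \<otimes>\<^bsub>T\<^esub> \<lbrace>R, V\<rbrace>\<^bsub>T\<^esub>"
proof (induction R rule: tensor_induct)
  case R: (pure p q)
  from R(3,4) show ?case
  proof (induction S rule: tensor_induct)
    case S: (pure r s)
    from S(3) show ?case
    proof (induction V rule: tensor_induct)
      case (pure t v)
      then show ?case using R S
        by (simp add: bracket_pure mult_pure addT cl U.leibniz Q.leibniz pure_add_left pure_add_right
            T.a_ac U.m_ac Q.m_ac)
    qed (use R S in \<open>simp add: addT cl T.a_ac\<close>)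
  qed (use R in \<open>simp add: addT cl T.a_ac\<close>)
qed (simp add: addT cl T.a_ac)


lemma pure_minus_left: "u \<in> carrier U \<Longrightarrow> q \<in> carrier Q \<Longrightarrow> pt (\<ominus>\<^bsub>U\<^esub> u) q = \<ominus>\<^bsub>T\<^esub> pt u q"
  by (rule T.minus_equality[symmetric])
    (simp_all add: pure_closed pure_zero_left pure_add_left[symmetric] U.M.l_neg)

lemma pure_minus_right: "u \<in> carrier U \<Longrightarrow> q \<in> carrier Q \<Longrightarrow> pt u (\<ominus>\<^bsub>Q\<^esub> q) = \<ominus>\<^bsub>T\<^esub> pt u q"
  by (rule T.minus_equality[symmetric])
    (simp_all add: pure_closed pure_zero_right pure_add_right[symmetric] Q.M.l_neg)

lemma U_flip: "x \<in> carrier U \<Longrightarrow> y \<in> carrier U \<Longrightarrow> \<lbrace>x, y\<rbrace>\<^bsub>U\<^esub> = \<ominus>\<^bsub>U\<^esub> \<lbrace>y, x\<rbrace>\<^bsub>U\<^esub>"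
  by (rule U.M.minus_equality[symmetric]) (simp_all add: U_anti U.bracket_closed)
lemma Q_flip: "x \<in> carrier Q \<Longrightarrow> y \<in> carrier Q \<Longrightarrow> \<lbrace>x, y\<rbrace>\<^bsub>Q\<^esub> = \<ominus>\<^bsub>Q\<^esub> \<lbrace>y, x\<rbrace>\<^bsub>Q\<^esub>"
  by (rule Q.M.minus_equality[symmetric]) (simp_all add: Q_anti Q.bracket_closed)

lemma bracket3_pure:
  assumes "p \<in> carrier U" "q \<in> carrier Q" "r \<in> carrier U" "s \<in> carrier Q" "t \<in> carrier U" "v \<in> carrier Q"
  shows "\<lbrace>pt p q, \<lbrace>pt r s, pt t v\<rbrace>\<^bsub>T\<^esub>\<rbrace>\<^bsub>T\<^esub> =
    (pt (p \<otimes>\<^bsub>U\<^esub> (r \<otimes>\<^bsub>U\<^esub> t)) \<lbrace>q, \<lbrace>s, v\<rbrace>\<^bsub>Q\<^esub>\<rbrace>\<^bsub>Q\<^esub> \<oplus>\<^bsub>T\<^esub> pt \<lbrace>p, \<lbrace>r, t\<rbrace>\<^bsub>U\<^esub>\<rbrace>\<^bsub>U\<^esub> (q \<otimes>\<^bsub>Q\<^esub> (s \<otimes>\<^bsub>Q\<^esub> v))) \<oplus>\<^bsub>T\<^esub>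
    ((pt (t \<otimes>\<^bsub>U\<^esub> \<lbrace>p, r\<rbrace>\<^bsub>U\<^esub>) (q \<otimes>\<^bsub>Q\<^esub> \<lbrace>s, v\<rbrace>\<^bsub>Q\<^esub>) \<ominus>\<^bsub>T\<^esub> pt (r \<otimes>\<^bsub>U\<^esub> \<lbrace>t, p\<rbrace>\<^bsub>U\<^esub>) (q \<otimes>\<^bsub>Q\<^esub> \<lbrace>s, v\<rbrace>\<^bsub>Q\<^esub>)) \<oplus>\<^bsub>T\<^esub>
     (pt (p \<otimes>\<^bsub>U\<^esub> \<lbrace>r, t\<rbrace>\<^bsub>U\<^esub>) (v \<otimes>\<^bsub>Q\<^esub> \<lbrace>q, s\<rbrace>\<^bsub>Q\<^esub>) \<ominus>\<^bsub>T\<^esub> pt (p \<otimes>\<^bsub>U\<^esub> \<lbrace>r, t\<rbrace>\<^bsub>U\<^esub>) (s \<otimes>\<^bsub>Q\<^esub> \<lbrace>v, q\<rbrace>\<^bsub>Q\<^esub>)))"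
  using assms
  by (simp add: bracket_pure addT cl U.leibniz Q.leibniz pure_add_left pure_add_right
      U_flip[of p t] Q_flip[of q v] U.r_minus Q.r_minus pure_minus_left pure_minus_right
      T.minus_eq T.a_ac U.m_ac Q.m_ac)

lemma jacobi_sums:
  assumes "a1 \<in> carrier T" "a2 \<in> carrier T" "a3 \<in> carrier T" "b1 \<in> carrier T" "b2 \<in> carrier T" "b3 \<in> carrier T"
    "x1 \<in> carrier T" "x2 \<in> carrier T" "x3 \<in> carrier T" "x4 \<in> carrier T" "x5 \<in> carrier T" "x6 \<in> carrier T"
    and a: "a1 \<oplus>\<^bsub>T\<^esub> a2 \<oplus>\<^bsub>T\<^esub> a3 = \<zero>\<^bsub>T\<^esub>" and b: "b1 \<oplus>\<^bsub>T\<^esub> b2 \<oplus>\<^bsub>T\<^esub> b3 = \<zero>\<^bsub>T\<^esub>"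
  shows "((a1 \<oplus>\<^bsub>T\<^esub> b1) \<oplus>\<^bsub>T\<^esub> ((x1 \<ominus>\<^bsub>T\<^esub> x2) \<oplus>\<^bsub>T\<^esub> (x3 \<ominus>\<^bsub>T\<^esub> x4))) \<oplus>\<^bsub>T\<^esub>
    ((a2 \<oplus>\<^bsub>T\<^esub> b2) \<oplus>\<^bsub>T\<^esub> ((x4 \<ominus>\<^bsub>T\<^esub> x5) \<oplus>\<^bsub>T\<^esub> (x2 \<ominus>\<^bsub>T\<^esub> x6))) \<oplus>\<^bsub>T\<^esub>
    ((a3 \<oplus>\<^bsub>T\<^esub> b3) \<oplus>\<^bsub>T\<^esub> ((x6 \<ominus>\<^bsub>T\<^esub> x3) \<oplus>\<^bsub>T\<^esub> (x5 \<ominus>\<^bsub>T\<^esub> x1))) = \<zero>\<^bsub>T\<^esub>" (is "?l = _")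
proof -
  have "?l = (a1 \<oplus>\<^bsub>T\<^esub> a2 \<oplus>\<^bsub>T\<^esub> a3) \<oplus>\<^bsub>T\<^esub> (b1 \<oplus>\<^bsub>T\<^esub> b2 \<oplus>\<^bsub>T\<^esub> b3) \<oplus>\<^bsub>T\<^esub>
    (x1 \<oplus>\<^bsub>T\<^esub> \<ominus>\<^bsub>T\<^esub> x1) \<oplus>\<^bsub>T\<^esub> (x2 \<oplus>\<^bsub>T\<^esub> \<ominus>\<^bsub>T\<^esub> x2) \<oplus>\<^bsub>T\<^esub> (x3 \<oplus>\<^bsub>T\<^esub> \<ominus>\<^bsub>T\<^esub> x3) \<oplus>\<^bsub>T\<^esub>
    (x4 \<oplus>\<^bsub>T\<^esub> \<ominus>\<^bsub>T\<^esub> x4) \<oplus>\<^bsub>T\<^esub> (x5 \<oplus>\<^bsub>T\<^esub> \<ominus>\<^bsub>T\<^esub> x5) \<oplus>\<^bsub>T\<^esub> (x6 \<oplus>\<^bsub>T\<^esub> \<ominus>\<^bsub>T\<^esub> x6)"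
    using assms(1-12) by (simp only: T.minus_eq T.a_ac T.a_inv_closed T.a_closed)
  also have "\<dots> = \<zero>\<^bsub>T\<^esub>" using assms(1-12) by (simp add: a b T.r_neg)
  finally show ?thesis .
qed

lemma T_jacobi: "R \<in> carrier T \<Longrightarrow> S \<in> carrier T \<Longrightarrow> V \<in> carrier T \<Longrightarrow>
  \<lbrace>R, \<lbrace>S, V\<rbrace>\<^bsub>T\<^esub>\<rbrace>\<^bsub>T\<^esub> \<oplus>\<^bsub>T\<^esub> \<lbrace>S, \<lbrace>V, R\<rbrace>\<^bsub>T\<^esub>\<rbrace>\<^bsub>T\<^esub> \<oplus>\<^bsub>T\<^esub> \<lbrace>V, \<lbrace>R, S\<rbrace>\<^bsub>T\<^esub>\<rbrace>\<^bsub>T\<^esub> = \<zero>\<^bsub>T\<^esub>"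
proof (induction R rule: tensor_induct)
  case R: (pure p q)
  from R(3,4) show ?case
  proof (induction S rule: tensor_induct)
    case S: (pure r s)
    from S(3) show ?case
    proof (induction V rule: tensor_induct)
      case V: (pure t v)
      have a: "pt (p \<otimes>\<^bsub>U\<^esub> (r \<otimes>\<^bsub>U\<^esub> t)) \<lbrace>q, \<lbrace>s, v\<rbrace>\<^bsub>Q\<^esub>\<rbrace>\<^bsub>Q\<^esub> \<oplus>\<^bsub>T\<^esub> pt (r \<otimes>\<^bsub>U\<^esub> (t \<otimes>\<^bsub>U\<^esub> p)) \<lbrace>s, \<lbrace>v, q\<rbrace>\<^bsub>Q\<^esub>\<rbrace>\<^bsub>Q\<^esub> \<oplus>\<^bsub>T\<^esub>
          pt (t \<otimes>\<^bsub>U\<^esub> (p \<otimes>\<^bsub>U\<^esub> r)) \<lbrace>v, \<lbrace>q, s\<rbrace>\<^bsub>Q\<^esub>\<rbrace>\<^bsub>Q\<^esub> = \<zero>\<^bsub>T\<^esub>"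
        using R S V Q.jacobi[of q s v] by (simp add: U.m_ac cl pure_add_right[symmetric] pure_zero_right)
      have b: "pt \<lbrace>p, \<lbrace>r, t\<rbrace>\<^bsub>U\<^esub>\<rbrace>\<^bsub>U\<^esub> (q \<otimes>\<^bsub>Q\<^esub> (s \<otimes>\<^bsub>Q\<^esub> v)) \<oplus>\<^bsub>T\<^esub> pt \<lbrace>r, \<lbrace>t, p\<rbrace>\<^bsub>U\<^esub>\<rbrace>\<^bsub>U\<^esub> (s \<otimes>\<^bsub>Q\<^esub> (v \<otimes>\<^bsub>Q\<^esub> q)) \<oplus>\<^bsub>T\<^esub>
          pt \<lbrace>t, \<lbrace>p, r\<rbrace>\<^bsub>U\<^esub>\<rbrace>\<^bsub>U\<^esub> (v \<otimes>\<^bsub>Q\<^esub> (q \<otimes>\<^bsub>Q\<^esub> s)) = \<zero>\<^bsub>T\<^esub>"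
        using R S V U.jacobi[of p r t] by (simp add: Q.m_ac cl pure_add_left[symmetric] pure_zero_left)
      show ?case
        unfolding bracket3_pure[OF R(1,2) S(1,2) V] bracket3_pure[OF S(1,2) V R(1,2)] bracket3_pure[OF V R(1,2) S(1,2)]
        by (rule jacobi_sums[OF _ _ _ _ _ _ _ _ _ _ _ _ a b]) (use R S V in \<open>simp_all add: cl\<close>)
    next
      case (add V W)
      let ?J = "\<lambda>V. \<lbrace>pt p q, \<lbrace>pt r s, V\<rbrace>\<^bsub>T\<^esub>\<rbrace>\<^bsub>T\<^esub> \<oplus>\<^bsub>T\<^esub> \<lbrace>pt r s, \<lbrace>V, pt p q\<rbrace>\<^bsub>T\<^esub>\<rbrace>\<^bsub>T\<^esub> \<oplus>\<^bsub>T\<^esub> \<lbrace>V, \<lbrace>pt p q, pt r s\<rbrace>\<^bsub>T\<^esub>\<rbrace>\<^bsub>T\<^esub>"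
      have e: "?J (V \<oplus>\<^bsub>T\<^esub> W) = ?J V \<oplus>\<^bsub>T\<^esub> ?J W" using add(1,2) R S by (simp add: addT cl T.a_ac)
      show ?case by (simp only: e add T.r_zero T.zero_closed)
    qed
  next
    case (add S W)
    let ?J = "\<lambda>S. \<lbrace>pt p q, \<lbrace>S, V\<rbrace>\<^bsub>T\<^esub>\<rbrace>\<^bsub>T\<^esub> \<oplus>\<^bsub>T\<^esub> \<lbrace>S, \<lbrace>V, pt p q\<rbrace>\<^bsub>T\<^esub>\<rbrace>\<^bsub>T\<^esub> \<oplus>\<^bsub>T\<^esub> \<lbrace>V, \<lbrace>pt p q, S\<rbrace>\<^bsub>T\<^esub>\<rbrace>\<^bsub>T\<^esub>"
    have e: "?J (S \<oplus>\<^bsub>T\<^esub> W) = ?J S \<oplus>\<^bsub>T\<^esub> ?J W" using add(1,2) R by (simp add: addT cl T.a_ac)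
    show ?case by (simp only: e add T.r_zero T.zero_closed)
  qed
next
  case (add R W)
  let ?J = "\<lambda>R. \<lbrace>R, \<lbrace>S, V\<rbrace>\<^bsub>T\<^esub>\<rbrace>\<^bsub>T\<^esub> \<oplus>\<^bsub>T\<^esub> \<lbrace>S, \<lbrace>V, R\<rbrace>\<^bsub>T\<^esub>\<rbrace>\<^bsub>T\<^esub> \<oplus>\<^bsub>T\<^esub> \<lbrace>V, \<lbrace>R, S\<rbrace>\<^bsub>T\<^esub>\<rbrace>\<^bsub>T\<^esub>"
  have e: "?J (R \<oplus>\<^bsub>T\<^esub> W) = ?J R \<oplus>\<^bsub>T\<^esub> ?J W" using add(1,2,5,6) by (simp add: addT cl T.a_ac)
  show ?case by (simp only: e add T.r_zero T.zero_closed)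
qed

lemma T_poisson: "poisson_algebra F T"
proof -
  have "lie_algebra F T"
  proof (rule lie_algebra.intro)
    show "vectorspace F T"
      by (intro vectorspace.intro T_module U.field_axioms)
    show "lie_algebra_axioms F T"
      by unfold_locales (simp_all add: cl addT T_smult_left T_smult_right T_self T_jacobi)
  qed
  then show ?thesis
    by (intro poisson_algebra.intro poisson_algebra_axioms.intro T_algebra) (simp_all add: T_leibniz)
qed

end

theorem tensor_product_poisson:
  "poisson_algebra F U \<Longrightarrow> poisson_algebra F Q \<Longrightarrow> poisson_algebra F (tensor_product F U Q)"
  by (rule two_poisson.T_poisson) (rule two_poisson.intro)

lemma tensor_map_class:
  assumes "two_modules F U Q" "two_modules F U' Q'" "f \<in> module_hom F U U'" "g \<in> module_hom F Q Q'"
    and x: "x \<in> carrier (tensor_free U Q)"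
  shows "tensor_map F U' Q' f g (tensor_class F U Q x) =
    tensor_class F U' Q' (frag_extend (\<lambda>(u, q). frag_of (f u, g q)) x)"
proof -
  interpret A: two_modules F U Q by fact
  interpret B: two_modules F U' Q' by fact
  have f: "f u \<in> carrier U'" "f (u \<oplus>\<^bsub>U\<^esub> u') = f u \<oplus>\<^bsub>U'\<^esub> f u'" "a \<in> carrier F \<Longrightarrow> f (a \<odot>\<^bsub>U\<^esub> u) = a \<odot>\<^bsub>U'\<^esub> f u"
    if "u \<in> carrier U" "u' \<in> carrier U" for u u' a
    using assms(3) that by (auto simp: module_hom_def)
  have g: "g u \<in> carrier Q'" "g (u \<oplus>\<^bsub>Q\<^esub> u') = g u \<oplus>\<^bsub>Q'\<^esub> g u'" "a \<in> carrier F \<Longrightarrow> g (a \<odot>\<^bsub>Q\<^esub> u) = a \<odot>\<^bsub>Q'\<^esub> g u"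
    if "u \<in> carrier Q" "u' \<in> carrier Q" for u u' a
    using assms(4) that by (auto simp: module_hom_def)
  have "frag_extend (\<lambda>(u, q). frag_of (f u, g q)) y \<in> tensor_ker F U' Q'" if "y \<in> tensor_ker F U Q" for y
    by (rule A.lift_ker[OF that _ _ _ B.ker_0 B.ker_diff]) (use f g B.rel_closed in simp_all)
  from this[OF A.rep_cls(2)[OF x]] show ?thesis
    by (simp add: tensor_map_def B.cls_eq_iff frag_extend_diff)
qed

lemma tensor_map_pure:
  assumes "two_modules F U Q" "two_modules F U' Q'" "f \<in> module_hom F U U'" "g \<in> module_hom F Q Q'"
    and "u \<in> carrier U" "q \<in> carrier Q"
  shows "tensor_map F U' Q' f g (pure_tensor F U Q u q) = pure_tensor F U' Q' (f u) (g q)"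
  using assms(5,6) by (simp add: pure_tensor_def tensor_map_class[OF assms(1-4)])


section \<open>Universal Poisson algebras\<close>

text \<open>HOL cannot quantify over types inside a formula, so the test algebras \<open>Q\<close> have their carriers
  in the type \<open>'b\<close> of \<open>B\<close>; they are the objects of the category \<open>Poiss F\<close> on \<open>'b\<close>
  defined below.\<close>

definition universal_poisson_algebra ::
    "('f, 'm) ring_scheme \<Rightarrow> ('f, 'x) poisson \<Rightarrow> ('f, 'u) poisson \<Rightarrow>
      ('f, 'b) poisson \<Rightarrow> ('x \<Rightarrow> ('u \<times> 'b \<Rightarrow>\<^sub>0 int) set) \<Rightarrow> bool"
  where "universal_poisson_algebra F X U B \<psi> \<longleftrightarrow>
    poisson_algebra F B \<and>
    \<psi> \<in> poisson_hom F X (tensor_product F U B) \<and>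
    (\<forall>(Q :: ('f, 'b) poisson) f.
      poisson_algebra F Q \<longrightarrow> f \<in> poisson_hom F X (tensor_product F U Q) \<longrightarrow>
      (\<exists>!g. g \<in> poisson_hom F B Q \<and>
        compose (carrier X) (tensor_map F U Q id g) \<psi> = f))"


section \<open>Categories and functors\<close>

text \<open>Morphism sets are not required to be disjoint, so composition and the action of a
  functor on morphisms carry the objects involved as arguments;
  \<open>Comp C X Y Z g f\<close> is \<open>g \<circ> f\<close> for \<open>f : X \<rightarrow> Y\<close> and \<open>g : Y \<rightarrow> Z\<close>.\<close>

record ('o, 'm) category =
  Obj :: "'o set"
  Mor :: "'o \<Rightarrow> 'o \<Rightarrow> 'm set"
  Ident :: "'o \<Rightarrow> 'm"
  Comp :: "'o \<Rightarrow> 'o \<Rightarrow> 'o \<Rightarrow> 'm \<Rightarrow> 'm \<Rightarrow> 'm"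

locale category =
  fixes C :: "('o, 'm) category"
  assumes Ident_Mor: "X \<in> Obj C \<Longrightarrow> Ident C X \<in> Mor C X X"
    and Comp_Mor:
      "\<lbrakk>X \<in> Obj C; Y \<in> Obj C; Z \<in> Obj C; f \<in> Mor C X Y; g \<in> Mor C Y Z\<rbrakk> \<Longrightarrow>
        Comp C X Y Z g f \<in> Mor C X Z"
    and Comp_Ident_right:
      "\<lbrakk>X \<in> Obj C; Y \<in> Obj C; f \<in> Mor C X Y\<rbrakk> \<Longrightarrow> Comp C X X Y f (Ident C X) = f"
    and Comp_Ident_left:
      "\<lbrakk>X \<in> Obj C; Y \<in> Obj C; f \<in> Mor C X Y\<rbrakk> \<Longrightarrow> Comp C X Y Y (Ident C Y) f = f"
    and Comp_assoc:
      "\<lbrakk>W \<in> Obj C; X \<in> Obj C; Y \<in> Obj C; Z \<in> Obj C;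
        f \<in> Mor C W X; g \<in> Mor C X Y; h \<in> Mor C Y Z\<rbrakk> \<Longrightarrow>
        Comp C W X Z (Comp C X Y Z h g) f = Comp C W Y Z h (Comp C W X Y g f)"

definition opposite :: "('o, 'm) category \<Rightarrow> ('o, 'm) category"
  where "opposite C =
    \<lparr>Obj = Obj C, Mor = (\<lambda>X Y. Mor C Y X), Ident = Ident C,
     Comp = (\<lambda>X Y Z g f. Comp C Z Y X f g)\<rparr>"

definition full_subcategory :: "('o, 'm) category \<Rightarrow> ('o \<Rightarrow> bool) \<Rightarrow> ('o, 'm) category"
  where "full_subcategory C \<Phi> = C\<lparr>Obj := {X \<in> Obj C. \<Phi> X}\<rparr>"

locale covariant_functor = source: category C + target: category D
  for C :: "('o, 'm) category" and D :: "('p, 'n) category" +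
  fixes Fo :: "'o \<Rightarrow> 'p" and Fm :: "'o \<Rightarrow> 'o \<Rightarrow> 'm \<Rightarrow> 'n"
  assumes functor_Obj: "X \<in> Obj C \<Longrightarrow> Fo X \<in> Obj D"
    and functor_Mor:
      "\<lbrakk>X \<in> Obj C; Y \<in> Obj C; f \<in> Mor C X Y\<rbrakk> \<Longrightarrow> Fm X Y f \<in> Mor D (Fo X) (Fo Y)"
    and functor_Ident: "X \<in> Obj C \<Longrightarrow> Fm X X (Ident C X) = Ident D (Fo X)"
    and functor_Comp:
      "\<lbrakk>X \<in> Obj C; Y \<in> Obj C; Z \<in> Obj C; f \<in> Mor C X Y; g \<in> Mor C Y Z\<rbrakk> \<Longrightarrow>
        Fm X Z (Comp C X Y Z g f) = Comp D (Fo X) (Fo Y) (Fo Z) (Fm Y Z g) (Fm X Y f)"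

text \<open>The Poisson algebras over \<open>F\<close> with carrier in the type \<open>'a\<close>, which plays the role of the
  universe of sets.\<close>

definition Poiss :: "('f, 'm) ring_scheme \<Rightarrow> (('f, 'a) poisson, 'a \<Rightarrow> 'a) category"
  where "Poiss F =
    \<lparr>Obj = {X. poisson_algebra F X},
     Mor = poisson_hom F,
     Ident = (\<lambda>X. restrict id (carrier X)),
     Comp = (\<lambda>X Y Z g f. compose (carrier X) g f)\<rparr>"

definition Poiss_fd :: "('f, 'm) ring_scheme \<Rightarrow> (('f, 'a) poisson, 'a \<Rightarrow> 'a) category"
  where "Poiss_fd F = full_subcategory (Poiss F) (vectorspace.fin_dim F)"

end

theory Submission
  imports Defs
begin

text \<open>
  Both functors come from one construction.  A Poisson homomorphism \<open>k : X \<rightarrow> U \<otimes> Q\<close> factors through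
  \<open>\<psi> : X \<rightarrow> U \<otimes> B\<close> as \<open>k = (id \<otimes> h) \<circ> \<psi>\<close> for exactly one Poisson homomorphism \<open>h : B \<rightarrow> Q\<close>
  (\<open>induced_hom\<close>).  A morphism \<open>f : X \<rightarrow> Y\<close> in the first variable gives the map \<open>\<psi>\<^sub>Y \<circ> f\<close>
  from \<open>X\<close> to \<open>U \<otimes> B(Y, U)\<close>, and a morphism \<open>f : B \<rightarrow> A\<close> in the second variable gives the map
  \<open>(f \<otimes> id) \<circ> \<psi>\<^sub>B\<close> from \<open>P\<close> to \<open>A \<otimes> B(P, B)\<close>.  The functors send \<open>f\<close> to the homomorphisms
  that these two maps induce, so their defining property is the universal property itself.

  For this the two maps must be Poisson homomorphisms, so \<open>f \<otimes> g\<close> has to be one whenever \<open>f\<close> and \<open>g\<close>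
  are (\<open>tensor_map_poisson_hom\<close>).  The functor laws are instances of uniqueness: the identity
  and a composite of induced maps satisfy the equation that characterises the map induced by an identity
  or by a composite (\<open>induced_hom_id\<close>, \<open>induced_hom_comp\<close>).  Checking the equation uses only that
  \<open>\<otimes>\<close> is a bifunctor (\<open>tensor_map_id\<close>, \<open>tensor_map_comp\<close>); in the second variable it includes
  the interchange \<open>(id \<otimes> h) \<circ> (f \<otimes> id) = (f \<otimes> id) \<circ> (id \<otimes> h)\<close>.
\<close>

section \<open>The category of Poisson algebras\<close>

lemma poisson_homI:
  assumes "\<And>x. x \<in> carrier A \<Longrightarrow> h x \<in> carrier B"
    and "\<And>x y. x \<in> carrier A \<Longrightarrow> y \<in> carrier A \<Longrightarrow> h (x \<oplus>\<^bsub>A\<^esub> y) = h x \<oplus>\<^bsub>B\<^esub> h y"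
    and "\<And>a x. a \<in> carrier F \<Longrightarrow> x \<in> carrier A \<Longrightarrow> h (a \<odot>\<^bsub>A\<^esub> x) = a \<odot>\<^bsub>B\<^esub> h x"
    and "\<And>x y. x \<in> carrier A \<Longrightarrow> y \<in> carrier A \<Longrightarrow> h (x \<otimes>\<^bsub>A\<^esub> y) = h x \<otimes>\<^bsub>B\<^esub> h y"
    and "\<And>x y. x \<in> carrier A \<Longrightarrow> y \<in> carrier A \<Longrightarrow> h \<lbrace>x, y\<rbrace>\<^bsub>A\<^esub> = \<lbrace>h x, h y\<rbrace>\<^bsub>B\<^esub>"
    and "h \<one>\<^bsub>A\<^esub> = \<one>\<^bsub>B\<^esub>"
    and "h \<in> extensional (carrier A)"
  shows "h \<in> poisson_hom F A B"
  using assms by (auto simp: poisson_hom_def module_hom_def ring_hom_def)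

lemma poisson_homD:
  assumes "h \<in> poisson_hom F A B"
  shows "x \<in> carrier A \<Longrightarrow> h x \<in> carrier B"
    and "x \<in> carrier A \<Longrightarrow> y \<in> carrier A \<Longrightarrow> h (x \<oplus>\<^bsub>A\<^esub> y) = h x \<oplus>\<^bsub>B\<^esub> h y"
    and "a \<in> carrier F \<Longrightarrow> x \<in> carrier A \<Longrightarrow> h (a \<odot>\<^bsub>A\<^esub> x) = a \<odot>\<^bsub>B\<^esub> h x"
    and "x \<in> carrier A \<Longrightarrow> y \<in> carrier A \<Longrightarrow> h (x \<otimes>\<^bsub>A\<^esub> y) = h x \<otimes>\<^bsub>B\<^esub> h y"
    and "x \<in> carrier A \<Longrightarrow> y \<in> carrier A \<Longrightarrow> h \<lbrace>x, y\<rbrace>\<^bsub>A\<^esub> = \<lbrace>h x, h y\<rbrace>\<^bsub>B\<^esub>"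
    and "h \<one>\<^bsub>A\<^esub> = \<one>\<^bsub>B\<^esub>"
    and "h \<in> extensional (carrier A)"
    and "h \<in> module_hom F A B"
  using assms by (auto simp: poisson_hom_def module_hom_def ring_hom_def)

lemma poisson_hom_id:
  assumes "poisson_algebra F A"
  shows "restrict id (carrier A) \<in> poisson_hom F A A"
proof -
  interpret poisson_algebra F A by fact
  show ?thesis by (rule poisson_homI) (simp_all add: bracket_closed)
qed

lemma poisson_hom_compose:
  assumes "poisson_algebra F A" and f: "f \<in> poisson_hom F A B" and g: "g \<in> poisson_hom F B C"
  shows "compose (carrier A) g f \<in> poisson_hom F A C"
proof -
  interpret poisson_algebra F A by fact
  show ?thesis
    by (rule poisson_homI)
      (simp_all add: compose_def bracket_closed poisson_homD(1-6)[OF f] poisson_homD(1-6)[OF g])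
qed

lemma category_Poiss:
  fixes F :: "('c, 'm) ring_scheme"
  shows "category (Poiss F :: (('c, 'd) poisson, 'd \<Rightarrow> 'd) category)"
proof
  fix W X Y Z :: "('c, 'd) poisson" and f g h
  assume "f \<in> Mor (Poiss F) W X" "g \<in> Mor (Poiss F) X Y" "h \<in> Mor (Poiss F) Y Z"
  then show "Comp (Poiss F) W X Z (Comp (Poiss F) X Y Z h g) f =
      Comp (Poiss F) W Y Z h (Comp (Poiss F) W X Y g f)"
    by (auto simp: Poiss_def compose_def fun_eq_iff dest: poisson_homD(1))
next
  fix X Y :: "('c, 'd) poisson" and f
  assume "f \<in> Mor (Poiss F) X Y"
  then have f: "f \<in> poisson_hom F X Y" by (simp add: Poiss_def)
  have f': "f x = undefined" if "x \<notin> carrier X" for x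
    using poisson_homD(7)[OF f] that by (rule extensional_arb)
  show "Comp (Poiss F) X X Y f (Ident (Poiss F) X) = f"
    using f' by (auto simp: Poiss_def compose_def fun_eq_iff)
  show "Comp (Poiss F) X Y Y (Ident (Poiss F) Y) f = f"
    using f' poisson_homD(1)[OF f] by (auto simp: Poiss_def compose_def fun_eq_iff)
qed (auto simp: Poiss_def poisson_hom_id poisson_hom_compose)

lemma category_full_subcategory: "category C \<Longrightarrow> category (full_subcategory C \<Phi>)"
  unfolding category_def full_subcategory_def by simp

lemma category_opposite: "category C \<Longrightarrow> category (opposite C)"
  by (rule category.intro;
      simp add: opposite_def category.Ident_Mor category.Comp_Mor category.Comp_Ident_left
        category.Comp_Ident_right category.Comp_assoc)


section \<open>Functoriality of the tensor product\<close>

text \<open>Morphisms are normalised to be \<open>undefined\<close> off the carrier, whereas the factor written \<open>id\<close> in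
  \<open>id \<otimes> h\<close> is the total identity function.  This lemma passes between the two: a representative of a tensor
  involves only pairs of elements of the carriers.\<close>

lemma tensor_map_cong:
  assumes "two_poisson F U Q" "R \<in> carrier (tensor_product F U Q)"
    and eq: "\<And>u. u \<in> carrier U \<Longrightarrow> f u = f' u" "\<And>q. q \<in> carrier Q \<Longrightarrow> g q = g' q"
  shows "tensor_map F U' Q' f g R = tensor_map F U' Q' f' g' R"
proof -
  interpret A: two_poisson F U Q by fact
  obtain x where "x \<in> carrier (tensor_free U Q)" "R = tensor_class F U Q x"
    using A.T_cases[OF assms(2)] by blast
  then have "Poly_Mapping.keys (tensor_rep R) \<subseteq> carrier U \<times> carrier Q"
    using A.rep_cls(1)[of x] by simp
  then have "frag_extend (\<lambda>(u, q). frag_of (f u, g q)) (tensor_rep R) =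
      frag_extend (\<lambda>(u, q). frag_of (f' u, g' q)) (tensor_rep R)"
    by (intro frag_extend_eq) (auto simp: eq)
  then show ?thesis by (simp add: tensor_map_def)
qed

lemma
  assumes "two_poisson F U Q" "two_poisson F U' Q'"
    and f: "f \<in> module_hom F U U'" and g: "g \<in> module_hom F Q Q'"
    and R: "R \<in> carrier (tensor_product F U Q)"
  shows tensor_map_closed: "tensor_map F U' Q' f g R \<in> carrier (tensor_product F U' Q')"
    and tensor_map_add: "S \<in> carrier (tensor_product F U Q) \<Longrightarrow>
      tensor_map F U' Q' f g (R \<oplus>\<^bsub>tensor_product F U Q\<^esub> S) =
      tensor_map F U' Q' f g R \<oplus>\<^bsub>tensor_product F U' Q'\<^esub> tensor_map F U' Q' f g S"
proof -
  interpret A: two_poisson F U Q by fact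
  interpret B: two_poisson F U' Q' by fact
  let ?\<phi> = "frag_extend (\<lambda>(u, q). frag_of (f u, g q))"
  have cls: "tensor_map F U' Q' f g (A.cls x) = B.cls (?\<phi> x)" if "x \<in> carrier A.G" for x
    by (rule tensor_map_class[OF A.two_modules_axioms B.two_modules_axioms f g that])
  have \<phi>: "?\<phi> x \<in> carrier B.G" if "x \<in> carrier A.G" for x
    by (rule A.lift_closed[OF that _ B.G_0 B.G_diff])
      (use module_hom_closed[OF f] module_hom_closed[OF g] in auto)
  obtain x where x: "x \<in> carrier A.G" "R = A.cls x"
    using A.T_cases R by blast
  then show "tensor_map F U' Q' f g R \<in> carrier B.T" by (simp only: cls \<phi> B.cls_closed)
  assume "S \<in> carrier A.T"
  then obtain y where "y \<in> carrier A.G" "S = A.cls y"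
    using A.T_cases by blast
  with x show "tensor_map F U' Q' f g (R \<oplus>\<^bsub>A.T\<^esub> S) =
      tensor_map F U' Q' f g R \<oplus>\<^bsub>B.T\<^esub> tensor_map F U' Q' f g S"
    by (simp only: cls \<phi> A.cls_add B.cls_add A.G_add frag_extend_add)
qed

text \<open>Both sides of each homomorphism law are additive in every tensor argument, so the law only has to be
  checked on pure tensors, where it follows from the same laws for \<open>f\<close> and \<open>g\<close>.\<close>

lemma tensor_map_poisson_hom:
  assumes "two_poisson F U Q" "two_poisson F U' Q'"
    and f: "f \<in> poisson_hom F U U'" and g: "g \<in> poisson_hom F Q Q'"
  shows "restrict (tensor_map F U' Q' f g) (carrier (tensor_product F U Q)) \<in>
    poisson_hom F (tensor_product F U Q) (tensor_product F U' Q')"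
proof -
  interpret A: two_poisson F U Q by fact
  interpret B: two_poisson F U' Q' by fact
  let ?t = "tensor_map F U' Q' f g"
  note mod = poisson_homD(8)[OF f] poisson_homD(8)[OF g]
  note f' = poisson_homD(1-6)[OF f] and g' = poisson_homD(1-6)[OF g]
  have t_pure: "?t (A.pt u q) = B.pt (f u) (g q)" if "u \<in> carrier U" "q \<in> carrier Q" for u q
    by (rule tensor_map_pure[OF A.two_modules_axioms B.two_modules_axioms mod that])
  have t_cl: "?t R \<in> carrier B.T" if "R \<in> carrier A.T" for R
    by (rule tensor_map_closed[OF assms(1,2) mod that])
  have t_add: "?t (R \<oplus>\<^bsub>A.T\<^esub> S) = ?t R \<oplus>\<^bsub>B.T\<^esub> ?t S" if "R \<in> carrier A.T" "S \<in> carrier A.T" for R S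
    by (rule tensor_map_add[OF assms(1,2) mod that])
  have smult: "?t (a \<odot>\<^bsub>A.T\<^esub> R) = a \<odot>\<^bsub>B.T\<^esub> ?t R" if "a \<in> carrier F" "R \<in> carrier A.T" for a R
    using that(2)
  proof (induction R rule: A.tensor_induct)
    case (pure u q)
    then show ?case using that(1) by (simp add: A.smult_pure B.smult_pure t_pure f' g')
  next
    case (add R S)
    then show ?case using that(1) by (simp add: A.smult_T_add B.smult_T_add A.smult_T_closed t_add t_cl)
  qed
  have mult: "?t (R \<otimes>\<^bsub>A.T\<^esub> S) = ?t R \<otimes>\<^bsub>B.T\<^esub> ?t S" if "R \<in> carrier A.T" "S \<in> carrier A.T" for R S
    using that
  proof (induction R rule: A.tensor_induct)
    case R: (pure p q)
    from R(3) show ?case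
    proof (induction S rule: A.tensor_induct)
      case (pure r s)
      then show ?case using R by (simp add: A.mult_pure B.mult_pure t_pure f' g')
    next
      case (add S S')
      then show ?case using R by (simp add: A.addT B.addT A.cl t_add t_cl)
    qed
  next
    case (add R R')
    then show ?case by (simp add: A.addT B.addT A.cl t_add t_cl)
  qed
  have bracket: "?t \<lbrace>R, S\<rbrace>\<^bsub>A.T\<^esub> = \<lbrace>?t R, ?t S\<rbrace>\<^bsub>B.T\<^esub>" if "R \<in> carrier A.T" "S \<in> carrier A.T" for R S
    using that
  proof (induction R rule: A.tensor_induct)
    case R: (pure p q)
    from R(3) show ?case
    proof (induction S rule: A.tensor_induct)
      case (pure r s)
      then show ?case using R by (simp add: A.bracket_pure B.bracket_pure A.cl t_add t_pure f' g')
    next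
      case (add S S')
      then show ?case using R by (simp add: A.addT B.addT A.cl t_add t_cl)
    qed
  next
    case (add R R')
    then show ?case by (simp add: A.addT B.addT A.cl t_add t_cl)
  qed
  show ?thesis
    by (rule poisson_homI)
      (simp_all add: t_cl t_add smult mult bracket A.cl A.one_T B.one_T t_pure f' g')
qed

text \<open>Asking only that the restrictions of \<open>f\<close> and \<open>g\<close> be morphisms admits the total function
  \<open>id\<close> as one of the factors.\<close>

lemma compose_tensor_map_poisson_hom:
  assumes "poisson_algebra F X" and A: "two_poisson F U Q" and B: "two_poisson F U' Q'"
    and f: "restrict f (carrier U) \<in> poisson_hom F U U'"
    and g: "restrict g (carrier Q) \<in> poisson_hom F Q Q'"
    and k: "k \<in> poisson_hom F X (tensor_product F U Q)"
  shows "compose (carrier X) (tensor_map F U' Q' f g) k \<in> poisson_hom F X (tensor_product F U' Q')"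
proof -
  let ?t = "tensor_map F U' Q' (restrict f (carrier U)) (restrict g (carrier Q))"
  have "compose (carrier X) (tensor_map F U' Q' f g) k =
      compose (carrier X) (restrict ?t (carrier (tensor_product F U Q))) k"
  proof (rule extensionalityI[OF compose_extensional compose_extensional])
    fix x assume x: "x \<in> carrier X"
    note kx = poisson_homD(1)[OF k x]
    have "tensor_map F U' Q' f g (k x) = ?t (k x)"
      by (rule tensor_map_cong[OF A kx]) simp_all
    then show "compose (carrier X) (tensor_map F U' Q' f g) k x =
        compose (carrier X) (restrict ?t (carrier (tensor_product F U Q))) k x"
      using x kx by (simp add: compose_eq)
  qed
  then show ?thesis
    using poisson_hom_compose[OF assms(1) k tensor_map_poisson_hom[OF A B f g]] by simp
qed

lemma id_module_hom: "id \<in> module_hom F M M"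
  by (auto simp: module_hom_def)

lemma tensor_map_id:
  assumes A: "two_poisson F U Q" and R: "R \<in> carrier (tensor_product F U Q)"
    and eq: "\<And>u. u \<in> carrier U \<Longrightarrow> f u = u" "\<And>q. q \<in> carrier Q \<Longrightarrow> g q = q"
  shows "tensor_map F U Q f g R = R"
proof -
  interpret A: two_poisson F U Q by fact
  have hom: "f \<in> module_hom F U U" "g \<in> module_hom F Q Q"
    using eq by (auto simp: module_hom_def)
  from R show ?thesis
  proof (induction R rule: A.tensor_induct)
    case (pure u q)
    then show ?case
      by (simp add: tensor_map_pure[OF A.two_modules_axioms A.two_modules_axioms hom] eq)
  next
    case (add R S)
    then show ?case by (simp add: tensor_map_add[OF A A hom])
  qed
qed

text \<open>The composites \<open>f''\<close> and \<open>g''\<close> are prescribed on the carriers only.  They can thus be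
  the extensional composites of the category or a plain \<open>id\<close>, and the same \<open>f''\<close> and \<open>g''\<close>
  can be split in several ways, which yields the interchange law.\<close>

lemma tensor_map_comp:
  assumes A: "two_poisson F U Q" and B: "two_poisson F U' Q'" and C: "two_poisson F U'' Q''"
    and f: "f \<in> module_hom F U U'" and g: "g \<in> module_hom F Q Q'"
    and f': "f' \<in> module_hom F U' U''" and g': "g' \<in> module_hom F Q' Q''"
    and R: "R \<in> carrier (tensor_product F U Q)"
    and eq: "\<And>u. u \<in> carrier U \<Longrightarrow> f' (f u) = f'' u" "\<And>q. q \<in> carrier Q \<Longrightarrow> g' (g q) = g'' q"
  shows "tensor_map F U'' Q'' f' g' (tensor_map F U' Q' f g R) = tensor_map F U'' Q'' f'' g'' R"
proof -
  interpret A: two_poisson F U Q by fact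
  interpret B: two_poisson F U' Q' by fact
  interpret C: two_poisson F U'' Q'' by fact
  note cl = module_hom_closed[OF f, THEN funcset_mem] module_hom_closed[OF g, THEN funcset_mem]
  have hom: "f'' \<in> module_hom F U U''" "g'' \<in> module_hom F Q Q''"
    using f g f' g' by (simp_all add: module_hom_def Pi_iff eq[symmetric])
  from R show ?thesis
  proof (induction R rule: A.tensor_induct)
    case (pure u q)
    then show ?case
      by (simp add: cl eq tensor_map_pure[OF A.two_modules_axioms B.two_modules_axioms f g]
          tensor_map_pure[OF B.two_modules_axioms C.two_modules_axioms f' g']
          tensor_map_pure[OF A.two_modules_axioms C.two_modules_axioms hom])
  next
    case (add R S)
    then show ?case
      by (simp add: tensor_map_add[OF A B f g] tensor_map_add[OF B C f' g']
          tensor_map_add[OF A C hom] tensor_map_closed[OF A B f g])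
  qed
qed


section \<open>Maps induced by the universal property\<close>

text \<open>The description operator returns the factorisation only if it exists and is unique; for other arguments
  the value is arbitrary.\<close>

definition induced_hom ::
    "('f, 'm) ring_scheme \<Rightarrow> ('f, 'x) poisson \<Rightarrow> ('f, 'u) poisson \<Rightarrow> ('f, 'b) poisson \<Rightarrow>
      ('x \<Rightarrow> ('u \<times> 'b \<Rightarrow>\<^sub>0 int) set) \<Rightarrow> ('f, 'b) poisson \<Rightarrow> ('x \<Rightarrow> ('u \<times> 'b \<Rightarrow>\<^sub>0 int) set) \<Rightarrow> 'b \<Rightarrow> 'b"
  where "induced_hom F X U B \<psi> Q k =
    (THE h. h \<in> poisson_hom F B Q \<and> compose (carrier X) (tensor_map F U Q id h) \<psi> = k)"

lemma universal_poisson_algebraD: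
  assumes "universal_poisson_algebra F X U B \<psi>"
  shows "poisson_algebra F B" and "\<psi> \<in> poisson_hom F X (tensor_product F U B)"
  using assms by (simp_all add: universal_poisson_algebra_def)

lemma eq_induced_hom_iff:
  assumes "universal_poisson_algebra F X U B \<psi>" "poisson_algebra F Q"
    and "k \<in> poisson_hom F X (tensor_product F U Q)"
  shows "h = induced_hom F X U B \<psi> Q k \<longleftrightarrow>
    h \<in> poisson_hom F B Q \<and> compose (carrier X) (tensor_map F U Q id h) \<psi> = k"
proof -
  have "\<exists>!h. h \<in> poisson_hom F B Q \<and> compose (carrier X) (tensor_map F U Q id h) \<psi> = k"
    using assms by (simp add: universal_poisson_algebra_def)
  from theI'[OF this] this show ?thesis
    unfolding induced_hom_def by blast
qed

lemma
  assumes "universal_poisson_algebra F X U B \<psi>" "poisson_algebra F Q"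
    and "k \<in> poisson_hom F X (tensor_product F U Q)"
  shows induced_hom_poisson_hom: "induced_hom F X U B \<psi> Q k \<in> poisson_hom F B Q"
    and tensor_map_induced_hom:
      "x \<in> carrier X \<Longrightarrow> tensor_map F U Q id (induced_hom F X U B \<psi> Q k) (\<psi> x) = k x"
proof -
  let ?h = "induced_hom F X U B \<psi> Q k"
  have h: "?h \<in> poisson_hom F B Q" "compose (carrier X) (tensor_map F U Q id ?h) \<psi> = k"
    using eq_induced_hom_iff[OF assms, of ?h] by simp_all
  show "?h \<in> poisson_hom F B Q" by (rule h(1))
  show "tensor_map F U Q id ?h (\<psi> x) = k x" if "x \<in> carrier X"
    using fun_cong[OF h(2), of x] that by (simp add: compose_eq)
qed

lemma eq_induced_homI:
  assumes "universal_poisson_algebra F X U B \<psi>" "poisson_algebra F Q"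
    and k: "k \<in> poisson_hom F X (tensor_product F U Q)" and "h \<in> poisson_hom F B Q"
    and "\<And>x. x \<in> carrier X \<Longrightarrow> tensor_map F U Q id h (\<psi> x) = k x"
  shows "h = induced_hom F X U B \<psi> Q k"
proof -
  have "compose (carrier X) (tensor_map F U Q id h) \<psi> = k"
    by (rule extensionalityI[OF compose_extensional poisson_homD(7)[OF k]])
      (simp add: compose_eq assms(5))
  then show ?thesis
    using eq_induced_hom_iff[OF assms(1-3)] assms(4) by blast
qed

text \<open>The identity of \<open>B\<close> factors \<open>\<psi>\<close> through itself, so uniqueness leaves no other
  choice.  The map \<open>k\<close> equals \<open>\<psi>\<close>; it is given by its values because it arises as a composite of
  \<open>\<psi>\<close> with identities.\<close>

lemma induced_hom_id:
  assumes X: "poisson_algebra F X" and U: "poisson_algebra F U"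
    and univ: "universal_poisson_algebra F X U B \<psi>"
    and k: "\<And>x. x \<in> carrier X \<Longrightarrow> k x = \<psi> x" "k \<in> extensional (carrier X)"
  shows "induced_hom F X U B \<psi> B k = restrict id (carrier B)"
proof (rule eq_induced_homI[symmetric])
  note B = universal_poisson_algebraD[OF univ]
  have UB: "two_poisson F U B" by (intro two_poisson.intro U B)
  have "k = \<psi>"
    by (rule extensionalityI[OF k(2) poisson_homD(7)[OF B(2)] k(1)])
  then show "k \<in> poisson_hom F X (tensor_product F U B)" using B(2) by simp
  show "restrict id (carrier B) \<in> poisson_hom F B B" by (rule poisson_hom_id[OF B(1)])
  show "tensor_map F U B id (restrict id (carrier B)) (\<psi> x) = k x" if "x \<in> carrier X" for x
    using poisson_homD(1)[OF B(2) that] k(1)[OF that] by (simp add: tensor_map_id[OF UB])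
  show "universal_poisson_algebra F X U B \<psi>" "poisson_algebra F B" by fact+
qed

text \<open>If \<open>h\<close> is induced by \<open>k\<close>, then \<open>(id \<otimes> (g \<circ> h)) \<circ> \<psi> = (id \<otimes> g) \<circ> k\<close>, so \<open>g \<circ> h\<close> is
  the map induced by \<open>(id \<otimes> g) \<circ> k\<close>.  With \<open>g\<close> itself an induced map, this gives preservation of
  composition for both functors.\<close>

lemma induced_hom_comp:
  assumes U: "poisson_algebra F U" and univ: "universal_poisson_algebra F X U B \<psi>"
    and Q: "poisson_algebra F Q" and R: "poisson_algebra F R"
    and k: "k \<in> poisson_hom F X (tensor_product F U Q)"
    and g: "g \<in> poisson_hom F Q R"
    and l: "l \<in> poisson_hom F X (tensor_product F U R)"
    and eq: "\<And>x. x \<in> carrier X \<Longrightarrow> tensor_map F U R id g (k x) = l x"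
  shows "induced_hom F X U B \<psi> R l = compose (carrier B) g (induced_hom F X U B \<psi> Q k)"
proof (rule eq_induced_homI[OF univ R l, symmetric])
  note B = universal_poisson_algebraD[OF univ]
  let ?h = "induced_hom F X U B \<psi> Q k"
  have h: "?h \<in> poisson_hom F B Q" by (rule induced_hom_poisson_hom[OF univ Q k])
  show "compose (carrier B) g ?h \<in> poisson_hom F B R"
    by (rule poisson_hom_compose[OF B(1) h g])
  show "tensor_map F U R id (compose (carrier B) g ?h) (\<psi> x) = l x" if x: "x \<in> carrier X" for x
  proof -
    have "tensor_map F U R id g (tensor_map F U Q id ?h (\<psi> x)) =
        tensor_map F U R id (compose (carrier B) g ?h) (\<psi> x)"
      by (rule tensor_map_comp[where U = U and Q = B])
        (simp_all add: two_poisson.intro U B(1) Q R id_module_hom poisson_homD(8)[OF g]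
          poisson_homD(8)[OF h] poisson_homD(1)[OF B(2) x] compose_eq)
    then show ?thesis
      using eq[OF x] tensor_map_induced_hom[OF univ Q k x] by simp
  qed
qed


section \<open>The two functors\<close>

text \<open>For \<open>f : X \<rightarrow> Y\<close> and \<open>g : Y \<rightarrow> Z\<close>, the equation required by
  \<open>induced_hom_comp\<close> is the defining equation of the image of \<open>g\<close>, evaluated at \<open>f x\<close>.\<close>

lemma covariant_functor_universal:
  fixes F :: "('f, 'm) ring_scheme" and U :: "('f, 'u) poisson"
    and \<B> :: "('f, 'x) poisson \<Rightarrow> ('f, 'b) poisson"
  assumes U: "poisson_algebra F U"
    and univ: "\<And>X. poisson_algebra F X \<Longrightarrow> universal_poisson_algebra F X U (\<B> X) (\<psi> X)"
  shows "covariant_functor (Poiss F) (Poiss F) \<B>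
    (\<lambda>X Y f. induced_hom F X U (\<B> X) (\<psi> X) (\<B> Y) (compose (carrier X) (\<psi> Y) f))"
    (is "covariant_functor _ _ _ ?L")
proof -
  note B = universal_poisson_algebraD[OF univ]
  have hom: "compose (carrier X) (\<psi> Y) f \<in> poisson_hom F X (tensor_product F U (\<B> Y))"
    if "poisson_algebra F X" "poisson_algebra F Y" "f \<in> poisson_hom F X Y" for X Y f
    by (rule poisson_hom_compose[OF that(1,3) B(2)[OF that(2)]])
  have L: "?L X Y f \<in> poisson_hom F (\<B> X) (\<B> Y)"
    if "poisson_algebra F X" "poisson_algebra F Y" "f \<in> poisson_hom F X Y" for X Y f
    by (rule induced_hom_poisson_hom[OF univ B(1) hom]) (use that in simp_all)
  have comp: "?L X Z (compose (carrier X) g f) = compose (carrier (\<B> X)) (?L Y Z g) (?L X Y f)"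
    if X: "poisson_algebra F X" and Y: "poisson_algebra F Y" and Z: "poisson_algebra F Z"
      and f: "f \<in> poisson_hom F X Y" and g: "g \<in> poisson_hom F Y Z" for X Y Z f g
  proof (rule induced_hom_comp[OF U univ[OF X] B(1)[OF Y] B(1)[OF Z] hom[OF X Y f] L[OF Y Z g]
          hom[OF X Z poisson_hom_compose[OF X f g]]])
    show "tensor_map F U (\<B> Z) id (?L Y Z g) (compose (carrier X) (\<psi> Y) f x) =
        compose (carrier X) (\<psi> Z) (compose (carrier X) g f) x" if "x \<in> carrier X" for x
      using tensor_map_induced_hom[OF univ[OF Y] B(1)[OF Z] hom[OF Y Z g], of "f x"]
        poisson_homD(1)[OF f that] that by (simp add: compose_eq)
  qed
  have ident: "?L X X (restrict id (carrier X)) = restrict id (carrier (\<B> X))"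
    if "poisson_algebra F X" for X
    by (rule induced_hom_id[OF that U univ[OF that]]) (simp_all add: compose_eq)
  show ?thesis
  proof (intro covariant_functor.intro covariant_functor_axioms.intro category_Poiss)
    fix X assume "X \<in> Obj (Poiss F :: (('f, 'x) poisson, 'x \<Rightarrow> 'x) category)"
    then have X: "poisson_algebra F X" by (simp add: Poiss_def)
    show "\<B> X \<in> Obj (Poiss F)" using B(1)[OF X] by (simp add: Poiss_def)
    show "?L X X (Ident (Poiss F) X) = Ident (Poiss F) (\<B> X)"
      using ident[OF X] by (simp only: Poiss_def category.simps)
    fix Y f assume "Y \<in> Obj (Poiss F :: (('f, 'x) poisson, 'x \<Rightarrow> 'x) category)"
      and "f \<in> Mor (Poiss F) X Y"
    then have Y: "poisson_algebra F Y" and f: "f \<in> poisson_hom F X Y" by (simp_all add: Poiss_def)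
    show "?L X Y f \<in> Mor (Poiss F) (\<B> X) (\<B> Y)"
      using L[OF X Y f] by (simp only: Poiss_def category.simps)
    fix Z g assume "Z \<in> Obj (Poiss F :: (('f, 'x) poisson, 'x \<Rightarrow> 'x) category)"
      and "g \<in> Mor (Poiss F) Y Z"
    then have Z: "poisson_algebra F Z" and g: "g \<in> poisson_hom F Y Z" by (simp_all add: Poiss_def)
    show "?L X Z (Comp (Poiss F) X Y Z g f) =
        Comp (Poiss F) (\<B> X) (\<B> Y) (\<B> Z) (?L Y Z g) (?L X Y f)"
      using comp[OF X Y Z f g] by (simp only: Poiss_def category.simps)
  qed
qed

text \<open>Here the morphisms \<open>f : Y \<rightarrow> X\<close> and \<open>g : Z \<rightarrow> Y\<close> act on the left tensor factor and the
  image \<open>h\<close> of \<open>g\<close> on the right one.  Interchanging \<open>f\<close> with \<open>h\<close> makes the defining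
  equation of \<open>h\<close> applicable:
  \<open>(id \<otimes> h) (f \<otimes> id) \<psi>\<^sub>Y = (f \<otimes> id) (id \<otimes> h) \<psi>\<^sub>Y = (f \<otimes> id) (g \<otimes> id) \<psi>\<^sub>Z = (f \<circ> g \<otimes> id) \<psi>\<^sub>Z\<close>.\<close>

lemma covariant_functor_universal_op:
  fixes F :: "('f, 'm) ring_scheme" and P :: "('f, 'x) poisson"
    and \<B> :: "('f, 'u) poisson \<Rightarrow> ('f, 'b) poisson"
  assumes P: "poisson_algebra F P"
    and univ: "\<And>A. poisson_algebra F A \<Longrightarrow> vectorspace.fin_dim F A \<Longrightarrow>
      universal_poisson_algebra F P A (\<B> A) (\<psi> A)"
  shows "covariant_functor (opposite (Poiss_fd F)) (Poiss F) \<B>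
    (\<lambda>A B f. induced_hom F P A (\<B> A) (\<psi> A) (\<B> B)
      (compose (carrier P) (tensor_map F A (\<B> B) f id) (\<psi> B)))"
    (is "covariant_functor _ _ _ ?R")
proof -
  let ?fd = "\<lambda>A :: ('f, 'u) poisson. poisson_algebra F A \<and> vectorspace.fin_dim F A"
  let ?k = "\<lambda>A B f. compose (carrier P) (tensor_map F A (\<B> B) f id) (\<psi> B)"
  have univ': "universal_poisson_algebra F P A (\<B> A) (\<psi> A)" if "?fd A" for A
    by (rule univ[OF conjunct1[OF that] conjunct2[OF that]])
  note B = universal_poisson_algebraD[OF univ']
  have two: "two_poisson F A (\<B> B)" if "?fd A" "?fd B" for A B
    by (rule two_poisson.intro[OF conjunct1[OF that(1)] B(1)[OF that(2)]])
  have hom: "?k A B f \<in> poisson_hom F P (tensor_product F A (\<B> B))"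
    if A: "?fd A" and B': "?fd B" and f: "f \<in> poisson_hom F B A" for A B f
  proof (rule compose_tensor_map_poisson_hom[OF P two[OF B' B'] two[OF A B'] _ _ B(2)[OF B']])
    show "restrict f (carrier B) \<in> poisson_hom F B A"
      using f by (simp only: extensional_restrict[OF poisson_homD(7)[OF f]])
    show "restrict id (carrier (\<B> B)) \<in> poisson_hom F (\<B> B) (\<B> B)"
      by (rule poisson_hom_id[OF B(1)[OF B']])
  qed
  have R: "?R A B f \<in> poisson_hom F (\<B> A) (\<B> B)"
    if "?fd A" "?fd B" "f \<in> poisson_hom F B A" for A B f
    by (rule induced_hom_poisson_hom[OF univ'[OF that(1)] B(1)[OF that(2)] hom[OF that]])
  have ident: "?R A A (restrict id (carrier A)) = restrict id (carrier (\<B> A))" if A: "?fd A" for A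
  proof (rule induced_hom_id[OF P conjunct1[OF A] univ'[OF A]])
    fix x assume x: "x \<in> carrier P"
    have "tensor_map F A (\<B> A) (restrict id (carrier A)) id (\<psi> A x) = \<psi> A x"
      by (rule tensor_map_id[OF two[OF A A] poisson_homD(1)[OF B(2)[OF A] x]]) simp_all
    then show "?k A A (restrict id (carrier A)) x = \<psi> A x"
      by (simp only: compose_eq x)
  qed (rule compose_extensional)
  have comp: "?R X Z (compose (carrier Z) f g) = compose (carrier (\<B> X)) (?R Y Z g) (?R X Y f)"
    if X: "?fd X" and Y: "?fd Y" and Z: "?fd Z"
      and f: "f \<in> poisson_hom F Y X" and g: "g \<in> poisson_hom F Z Y" for X Y Z f g
  proof (rule induced_hom_comp[OF _ univ'[OF X] B(1)[OF Y] B(1)[OF Z] hom[OF X Y f] R[OF Y Z g]])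
    show "poisson_algebra F X" using X by simp
    have "poisson_algebra F Z" using Z by simp
    then have "compose (carrier Z) f g \<in> poisson_hom F Z X"
      using g f by (rule poisson_hom_compose)
    then show "?k X Z (compose (carrier Z) f g) \<in> poisson_hom F P (tensor_product F X (\<B> Z))"
      by (rule hom[OF X Z])
    fix x assume x: "x \<in> carrier P"
    let ?h = "?R Y Z g"
    note \<psi>x = poisson_homD(1)[OF B(2)[OF Y] x] poisson_homD(1)[OF B(2)[OF Z] x]
    note mod = id_module_hom poisson_homD(8)[OF f] poisson_homD(8)[OF g] poisson_homD(8)[OF R[OF Y Z g]]
    have "tensor_map F X (\<B> Z) id ?h (tensor_map F X (\<B> Y) f id (\<psi> Y x)) =
        tensor_map F X (\<B> Z) f ?h (\<psi> Y x)"
      by (rule tensor_map_comp[OF two[OF Y Y] two[OF X Y] two[OF X Z]]) (simp_all add: mod \<psi>x)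
    also have "\<dots> = tensor_map F X (\<B> Z) f id (tensor_map F Y (\<B> Z) id ?h (\<psi> Y x))"
      by (rule tensor_map_comp[OF two[OF Y Y] two[OF Y Z] two[OF X Z], symmetric]) (simp_all add: mod \<psi>x)
    also have "tensor_map F Y (\<B> Z) id ?h (\<psi> Y x) = tensor_map F Y (\<B> Z) g id (\<psi> Z x)"
      using tensor_map_induced_hom[OF univ'[OF Y] B(1)[OF Z] hom[OF Y Z g] x]
      by (simp only: compose_eq x)
    also have "tensor_map F X (\<B> Z) f id (tensor_map F Y (\<B> Z) g id (\<psi> Z x)) =
        tensor_map F X (\<B> Z) (compose (carrier Z) f g) id (\<psi> Z x)"
      by (rule tensor_map_comp[OF two[OF Z Z] two[OF Y Z] two[OF X Z]]) (simp_all add: mod \<psi>x compose_eq)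
    finally show "tensor_map F X (\<B> Z) id ?h (?k X Y f x) = ?k X Z (compose (carrier Z) f g) x"
      by (simp only: compose_eq x)
  qed
  show ?thesis
  proof (intro covariant_functor.intro covariant_functor_axioms.intro category_Poiss)
    show "category (opposite (Poiss_fd F))"
      unfolding Poiss_fd_def by (intro category_opposite category_full_subcategory category_Poiss)
    note op = Poiss_def Poiss_fd_def full_subcategory_def opposite_def
    let ?D = "opposite (Poiss_fd F) :: (('f, 'u) poisson, 'u \<Rightarrow> 'u) category"
    fix X assume "X \<in> Obj ?D"
    then have X: "?fd X" by (simp add: op)
    show "\<B> X \<in> Obj (Poiss F)" using B(1)[OF X] by (simp add: Poiss_def)
    show "?R X X (Ident ?D X) = Ident (Poiss F) (\<B> X)"
      using ident[OF X] by (simp only: op category.simps)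
    fix Y f assume "Y \<in> Obj ?D" and "f \<in> Mor ?D X Y"
    then have Y: "?fd Y" and f: "f \<in> poisson_hom F Y X" by (simp_all add: op)
    show "?R X Y f \<in> Mor (Poiss F) (\<B> X) (\<B> Y)"
      using R[OF X Y f] by (simp only: op category.simps)
    fix Z g assume "Z \<in> Obj ?D" and "g \<in> Mor ?D Y Z"
    then have Z: "?fd Z" and g: "g \<in> poisson_hom F Z Y" by (simp_all add: op)
    show "?R X Z (Comp ?D X Y Z g f) =
        Comp (Poiss F) (\<B> X) (\<B> Y) (\<B> Z) (?R Y Z g) (?R X Y f)"
      using comp[OF X Y Z f g] by (simp only: op category.simps)
  qed
qed

theorem proposition3p4:
  fixes F :: "('f, 'm) ring_scheme"
    and P U :: "('f, 'a) poisson"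
    and \<B> :: "('f, 'a) poisson \<Rightarrow> ('f, 'a) poisson \<Rightarrow> ('f, 'a) poisson"
    and \<psi> :: "('f, 'a) poisson \<Rightarrow> ('f, 'a) poisson \<Rightarrow> 'a \<Rightarrow> ('a \<times> 'a \<Rightarrow>\<^sub>0 int) set"
  assumes "field F"
    and "poisson_algebra F P"
    and "poisson_algebra F U" and "vectorspace.fin_dim F U"
    and universal: "\<And>X V. \<lbrakk>poisson_algebra F X; poisson_algebra F V; vectorspace.fin_dim F V\<rbrakk> \<Longrightarrow>
      universal_poisson_algebra F X V (\<B> X V) (\<psi> X V)"
  shows
    "(\<exists>\<L>. covariant_functor (Poiss F) (Poiss F) (\<lambda>X. \<B> X U) \<L> \<and>
        (\<forall>X\<in>Obj (Poiss F). \<forall>Y\<in>Obj (Poiss F). \<forall>f\<in>Mor (Poiss F) X Y. \<forall>h.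
          h = \<L> X Y f \<longleftrightarrow>
          h \<in> Mor (Poiss F) (\<B> X U) (\<B> Y U) \<and>
          compose (carrier X) (tensor_map F U (\<B> Y U) id h) (\<psi> X U) = compose (carrier X) (\<psi> Y U) f)) \<and>
     (\<exists>\<R>. covariant_functor (opposite (Poiss_fd F)) (Poiss F) (\<lambda>A. \<B> P A) \<R> \<and>
        (\<forall>A\<in>Obj (Poiss_fd F). \<forall>B\<in>Obj (Poiss_fd F). \<forall>f\<in>Mor (Poiss_fd F) B A. \<forall>h.
          h = \<R> A B f \<longleftrightarrow>
          h \<in> Mor (Poiss F) (\<B> P A) (\<B> P B) \<and>
          compose (carrier P) (tensor_map F A (\<B> P B) id h) (\<psi> P A) =
            compose (carrier P) (tensor_map F A (\<B> P B) f id) (\<psi> P B)))"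
proof (intro conjI exI ballI allI)
  show "covariant_functor (Poiss F) (Poiss F) (\<lambda>X. \<B> X U)
      (\<lambda>X Y f. induced_hom F X U (\<B> X U) (\<psi> X U) (\<B> Y U) (compose (carrier X) (\<psi> Y U) f))"
    by (rule covariant_functor_universal) (use assms in blast)+
  show "covariant_functor (opposite (Poiss_fd F)) (Poiss F) (\<lambda>A. \<B> P A)
      (\<lambda>A B f. induced_hom F P A (\<B> P A) (\<psi> P A) (\<B> P B)
        (compose (carrier P) (tensor_map F A (\<B> P B) f id) (\<psi> P B)))"
    by (rule covariant_functor_universal_op) (use assms in blast)+
next
  fix X Y :: "('f, 'a) poisson" and f h
  assume "X \<in> Obj (Poiss F)" "Y \<in> Obj (Poiss F)" "f \<in> Mor (Poiss F) X Y"
  then have X: "poisson_algebra F X" and Y: "poisson_algebra F Y" and f: "f \<in> poisson_hom F X Y"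
    by (simp_all add: Poiss_def)
  note YU = universal_poisson_algebraD[OF universal[OF Y assms(3,4)]]
  note iff = eq_induced_hom_iff[OF universal[OF X assms(3,4)] YU(1) poisson_hom_compose[OF X f YU(2)]]
  show "h = induced_hom F X U (\<B> X U) (\<psi> X U) (\<B> Y U) (compose (carrier X) (\<psi> Y U) f) \<longleftrightarrow>
      h \<in> Mor (Poiss F) (\<B> X U) (\<B> Y U) \<and>
      compose (carrier X) (tensor_map F U (\<B> Y U) id h) (\<psi> X U) = compose (carrier X) (\<psi> Y U) f"
    unfolding iff by (simp add: Poiss_def)
next
  fix A B :: "('f, 'a) poisson" and f h
  assume "A \<in> Obj (Poiss_fd F)" "B \<in> Obj (Poiss_fd F)" "f \<in> Mor (Poiss_fd F) B A"
  then have A: "poisson_algebra F A" "vectorspace.fin_dim F A"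
    and B: "poisson_algebra F B" "vectorspace.fin_dim F B" and f: "f \<in> poisson_hom F B A"
    by (simp_all add: Poiss_fd_def full_subcategory_def Poiss_def)
  note PB = universal_poisson_algebraD[OF universal[OF assms(2) B]]
  have "compose (carrier P) (tensor_map F A (\<B> P B) f id) (\<psi> P B) \<in>
      poisson_hom F P (tensor_product F A (\<B> P B))"
    by (rule compose_tensor_map_poisson_hom[OF assms(2) _ _ _ _ PB(2)])
      (simp_all add: two_poisson.intro A B PB(1) f extensional_restrict[OF poisson_homD(7)[OF f]]
        poisson_hom_id)
  from eq_induced_hom_iff[OF universal[OF assms(2) A] PB(1) this]
  show "h = induced_hom F P A (\<B> P A) (\<psi> P A) (\<B> P B)
        (compose (carrier P) (tensor_map F A (\<B> P B) f id) (\<psi> P B)) \<longleftrightarrow>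
      h \<in> Mor (Poiss F) (\<B> P A) (\<B> P B) \<and>
      compose (carrier P) (tensor_map F A (\<B> P B) id h) (\<psi> P A) =
        compose (carrier P) (tensor_map F A (\<B> P B) f id) (\<psi> P B)"
    by (simp add: Poiss_def)
qed

end
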